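(* Let $a$ be a trigonometric polynomial satisfying $\deg(a)\le N$, $a(0)=1$ and $\|a\|_\infty\le C<\infty$. Let $\phi$ be the compactly supported distribution defined by $\widehat{\phi}(y)=\prod_{j=1}^\infty a(2^{-j}y)$, assume that the integer shifts of $\phi$ are linearly independent, and let $V_\phi=\operatorname{span}\{\phi(\cdot-\ell):\ \ell\in\mathbb{Z}\}$ be the shift-invariant space generated by $\phi$. If, for some $\lambda\in\mathbb{C}$ and some $d\in\mathbb{N}_0$, $d\le N$, the analytic function $e^{\lambda t}\sum_{k=0}^d p_k(t)\,\omega_k(t)$, $\omega_d\ne0$, belongs to $V_\phi$, where the $p_k$ are polynomials of degree $k$ and the functions $\omega_k$ are $1$-periodic and analytic on $\mathbb{R}$, then $\lambda=0$ and $\omega_k(t)\equiv\text{constant}$ for $k=0,\ldots,d$.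
   Context: A trigonometric polynomial of degree at most $N$ ($N\in\mathbb{N}$) is a function $a(y)=\sum_{m=0}^N \mathrm{a}_m\,e^{-2\pi i m y}$, $y\in\mathbb{R}$, with $\mathrm{a}_m\in\mathbb{R}$, and $\|a\|_\infty$ is its maximum norm on $\mathbb{R}$. The Fourier transform is $\widehat{\phi}(y)=\int_{\mathbb{R}}\phi(x)e^{-2\pi i xy}\,dx$. The span defining $V_\phi$ is understood as the set of all sums $\sum_{\ell\in\mathbb{Z}}c_\ell\,\phi(\cdot-\ell)$ with $(c_\ell)\in\ell(\mathbb{Z})$, where $\ell(\mathbb{Z})$ is the space of all complex sequences on $\mathbb{Z}$ (the sums are locally finite). The integer shifts of $\phi$ are linearly independent if $\sum_{\ell\in\mathbb{Z}}c_\ell\,\phi(\cdot-\ell)=0$ with $(c_\ell)\in\ell(\mathbb{Z})$ implies $c_\ell=0$ for all $\ell$. By convention, if some $p_j\equiv0$, the corresponding $\omega_j$ is set to be identically zero; $\omega_d\neq0$ means that $\omega_d$ is not identically zero. A function on $\mathbb{R}$ is analytic if it is infinitely differentiable on $\mathbb{R}$ and has a power series expansion around each point of $\mathbb{R}$.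
   Formalization: For complex-valued ω_k, λ is only determined modulo 2πi; so λ=0 and ω_k constant is proved when |Im λ|<2π or all ω_k are real-valued, and in general λ∈2πiℤ with every e^{λt}ω_k(t) constant. *)

theory Defs
  imports "HOL-Analysis.Analysis"
begin

definition trig_poly :: "nat \<Rightarrow> (real \<Rightarrow> complex) \<Rightarrow> bool" where
  "trig_poly N a \<longleftrightarrow> (\<exists>c :: nat \<Rightarrow> real. \<forall>y. a y =
     (\<Sum>m\<le>N. of_real (c m) * exp (- (2 * of_real pi * \<i> * of_nat m * of_real y))))"

definition max_norm :: "(real \<Rightarrow> complex) \<Rightarrow> real" where
  "max_norm a = (SUP y. norm (a y))"

definition higher_deriv :: "nat \<Rightarrow> (real \<Rightarrow> complex) \<Rightarrow> real \<Rightarrow> complex" where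
  "higher_deriv k f = ((\<lambda>g x. vector_derivative g (at x)) ^^ k) f"

definition smooth :: "(real \<Rightarrow> complex) \<Rightarrow> bool" where
  "smooth f \<longleftrightarrow> (\<forall>k x. higher_deriv k f differentiable (at x))"

definition real_analytic :: "(real \<Rightarrow> complex) \<Rightarrow> bool" where
  "real_analytic f \<longleftrightarrow> smooth f \<and>
     (\<forall>x. \<exists>r>0. \<exists>c :: nat \<Rightarrow> complex.
        \<forall>t. \<bar>t - x\<bar> < r \<longrightarrow> (\<lambda>n. c n * of_real (t - x) ^ n) sums f t)"

definition supp :: "(real \<Rightarrow> complex) \<Rightarrow> real set" where
  "supp f = closure {x. f x \<noteq> 0}"

definition test_fun :: "(real \<Rightarrow> complex) \<Rightarrow> bool" where
  "test_fun f \<longleftrightarrow> smooth f \<and> compact (supp f)"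

text \<open>A distribution is a functional on all functions of which only the values at test
  functions matter; accordingly, distributions are compared with \<open>dist_eq\<close>, never with equality.
  Continuity is expressed by the usual seminorm estimates on each compact set.\<close>

type_synonym functional = "(real \<Rightarrow> complex) \<Rightarrow> complex"

definition distribution :: "functional \<Rightarrow> bool" where
  "distribution u \<longleftrightarrow>
     (\<forall>f g. test_fun f \<longrightarrow> test_fun g \<longrightarrow> u (\<lambda>x. f x + g x) = u f + u g) \<and>
     (\<forall>c f. test_fun f \<longrightarrow> u (\<lambda>x. c * f x) = c * u f) \<and>
     (\<forall>K. compact K \<longrightarrow> (\<exists>B m. \<forall>f. test_fun f \<and> supp f \<subseteq> K \<longrightarrow>
        norm (u f) \<le> B * (\<Sum>k\<le>m. SUP x. norm (higher_deriv k f x))))"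

definition dist_eq :: "functional \<Rightarrow> functional \<Rightarrow> bool" where
  "dist_eq u v \<longleftrightarrow> (\<forall>f. test_fun f \<longrightarrow> u f = v f)"

definition compactly_supported :: "functional \<Rightarrow> bool" where
  "compactly_supported u \<longleftrightarrow>
     (\<exists>K. compact K \<and> (\<forall>f. test_fun f \<and> supp f \<inter> K = {} \<longrightarrow> u f = 0))"

text \<open>Pairing of a compactly supported distribution with an arbitrary smooth \<open>g\<close>: the common
  value of \<open>u (\<eta> g)\<close> for all test functions \<open>\<eta>\<close> that equal 1 on a sufficiently large compact set.\<close>

definition pairing :: "functional \<Rightarrow> (real \<Rightarrow> complex) \<Rightarrow> complex" where
  "pairing u g = (THE z. \<exists>K. compact K \<and>
     (\<forall>\<eta>. test_fun \<eta> \<and> (\<forall>x\<in>K. \<eta> x = 1) \<longrightarrow> u (\<lambda>x. \<eta> x * g x) = z))"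

definition fourier :: "functional \<Rightarrow> real \<Rightarrow> complex" where
  "fourier u y = pairing u (\<lambda>x. exp (- (2 * of_real pi * \<i> * of_real x * of_real y)))"

definition shift :: "int \<Rightarrow> functional \<Rightarrow> functional" where
  "shift l u = (\<lambda>f. u (\<lambda>x. f (x + of_int l)))"

text \<open>For a compactly supported \<open>\<phi>\<close>, the index set below is finite for every test function \<open>f\<close>
  (local finiteness), so this is the sum over all integers with arbitrary coefficients \<open>c\<close>.\<close>

definition shift_sum :: "functional \<Rightarrow> (int \<Rightarrow> complex) \<Rightarrow> functional" where
  "shift_sum \<phi> c = (\<lambda>f. \<Sum>l | shift l \<phi> f \<noteq> 0. c l * shift l \<phi> f)"

definition independent_shifts :: "functional \<Rightarrow> bool" where
  "independent_shifts \<phi> \<longleftrightarrow>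
     (\<forall>c. dist_eq (shift_sum \<phi> c) (\<lambda>f. 0) \<longrightarrow> (\<forall>l. c l = 0))"

definition shift_space :: "functional \<Rightarrow> functional set" where
  "shift_space \<phi> = {u. \<exists>c. dist_eq u (shift_sum \<phi> c)}"

definition regular_dist :: "(real \<Rightarrow> complex) \<Rightarrow> functional" where
  "regular_dist g = (\<lambda>f. LINT x|lborel. g x * f x)"

text \<open>The representation \<open>e\<^sup>\<lambda>\<^sup>t \<Sum>\<^sub>k p\<^sub>k(t) \<omega>\<^sub>k(t)\<close> determines \<open>\<lambda>\<close> only modulo \<open>2 \<pi> \<i> \<int>\<close> if the
  \<open>\<omega>\<^sub>k\<close> may be complex-valued, since the 1-periodic factor \<open>e\<^bsup>2 \<pi> \<i> n t\<^esup>\<close> can be moved into them: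
  already \<open>1 = e\<^bsup>2 \<pi> \<i> t\<^esup> e\<^bsup>- 2 \<pi> \<i> t\<^esup>\<close> has the required form with \<open>\<lambda> \<noteq> 0\<close>.
  It is unambiguous if \<open>\<bar>Im \<lambda>\<bar> < 2 \<pi>\<close> (for instance \<open>\<lambda>\<close> in the strip \<open>- \<pi> < Im \<lambda> \<le> \<pi>\<close> or in
  \<open>0 \<le> Im \<lambda> < 2 \<pi>\<close>), or if the \<open>\<omega>\<^sub>k\<close> are real-valued.\<close>

definition unambiguous_frequency :: "complex \<Rightarrow> nat \<Rightarrow> (nat \<Rightarrow> real \<Rightarrow> complex) \<Rightarrow> bool" where
  "unambiguous_frequency \<mu> d \<omega> \<longleftrightarrow> \<bar>Im \<mu>\<bar> < 2 * pi \<or> (\<forall>k\<le>d. \<forall>t. \<omega> k t \<in> \<real>)"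

end

theory Submission
  imports Defs "HOL-Complex_Analysis.Complex_Analysis"
begin

text \<open>Write \<open>V\<close> for the shift-invariant space and \<open>\<phi>^\<close> for the Fourier transform of \<open>\<phi>\<close>. The product formula says
\<open>\<phi>^(2 y) = a(y) \<phi>^(y)\<close>, and since the Fourier transform is injective on compactly
supported distributions, this is the two-scale relation that expresses \<open>\<phi>(x / 2)\<close> through
finitely many integer shifts of \<open>\<phi>\<close> (\<open>refinement_equation\<close>). Hence \<open>V\<close> is
invariant under \<open>f \<mapsto> f(\<cdot> / 2)\<close>.

On \<open>(-1, 1)\<close> only finitely many shifts of \<open>\<phi>\<close> are visible, so \<open>V\<close> restricted to this
interval has finite dimension. For \<open>f\<close> in \<open>V\<close> the dilates \<open>f(t / 2^i)\<close> are therefore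
linearly dependent there: \<open>\<Sum>\<^sub>i b\<^sub>i f(t / 2^i) = 0\<close> for some \<open>b \<noteq> 0\<close>
(\<open>dilates_dependent\<close>). If \<open>f\<close> is analytic with Taylor coefficients \<open>q\<^sub>k\<close> at 0,
comparing coefficients gives \<open>q\<^sub>k B(2^-k) = 0\<close> with the nonzero polynomial
\<open>B(x) = \<Sum>\<^sub>i b\<^sub>i x^i\<close>. As \<open>B\<close> has finitely many roots, almost all \<open>q\<^sub>k\<close> vanish, and by
the identity theorem \<open>f\<close> is a polynomial on the whole line
(\<open>analytic_in_shift_space_imp_polynomial\<close>).

It remains to see when \<open>e^(\<mu> t) \<Sum>\<^sub>k p\<^sub>k(t) \<omega>\<^sub>k(t)\<close> is a polynomial \<open>P(t)\<close>
(\<open>polynomial_periodic_expansion\<close>). At the points \<open>t + n\<close> with \<open>t\<close> fixed the periodic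
factors do not change, so one polynomial in \<open>n\<close> times \<open>e^(\<mu> n)\<close> equals another
polynomial in \<open>n\<close>. The quotient of the values of a nonzero polynomial at \<open>n + 1\<close> and \<open>n\<close> tends
to 1, which forces \<open>e^\<mu> = 1\<close>. Then the coefficients of both polynomials
agree. Since \<open>p\<^sub>k\<close> has degree \<open>k\<close> or vanishes together with \<open>\<omega>\<^sub>k\<close>, this is a triangular system, which
shows one after another, from \<open>k = d\<close> downwards, that the functions \<open>e^(\<mu> t) \<omega>\<^sub>k(t)\<close> are constant.\<close>

section \<open>Calculus of smooth functions and test functions\<close>

lemma higher_deriv_0 [simp]: "higher_deriv 0 f = f"
  by (simp add: higher_deriv_def)

lemma higher_deriv_Suc: "higher_deriv (Suc k) f = (\<lambda>x. vector_derivative (higher_deriv k f) (at x))"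
  by (simp add: higher_deriv_def)

lemma higher_deriv_Suc': "higher_deriv (Suc k) f = higher_deriv k (\<lambda>x. vector_derivative f (at x))"
  by (simp only: higher_deriv_def funpow_Suc_right o_def)

text \<open>A sequence in which each function is the derivative of the preceding one identifies all
iterated derivatives of its first member at once. The closure properties of smooth functions below
follow by writing down such a sequence.\<close>
lemma higher_deriv_chain:
  assumes "\<And>k x. (F k has_vector_derivative F (Suc k) x) (at x)"
  shows "higher_deriv k (F 0) = F k"
proof (induction k)
  case (Suc k)
  then show ?case
    using assms by (auto simp: higher_deriv_Suc vector_derivative_at)
qed simp

lemma smooth_chain:
  assumes "\<And>k x. (F k has_vector_derivative F (Suc k) x) (at x)"
  shows "smooth (F 0)"
  unfolding smooth_def higher_deriv_chain[of F, OF assms]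
  using assms differentiableI_vector by blast

lemma smooth_has_vector_derivative:
  assumes "smooth f"
  shows "(higher_deriv k f has_vector_derivative higher_deriv (Suc k) f x) (at x)"
  using assms unfolding smooth_def higher_deriv_Suc by (simp add: vector_derivative_works)

lemma smooth_imp_continuous_on: "smooth f \<Longrightarrow> continuous_on A (higher_deriv k f)"
  unfolding smooth_def
  by (meson continuous_at_imp_continuous_on differentiable_imp_continuous_within)

lemma smooth_derivative:
  assumes "smooth f"
  shows "(f has_vector_derivative higher_deriv 1 f x) (at x)"
    and "smooth (higher_deriv 1 f)"
    and "higher_deriv k (higher_deriv 1 f) = higher_deriv (Suc k) f"
proof -
  show "(f has_vector_derivative higher_deriv 1 f x) (at x)"
    using smooth_has_vector_derivative[OF assms, of 0 x] by simp
  show "smooth (higher_deriv 1 f)"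
    using smooth_chain[of "\<lambda>k. higher_deriv (Suc k) f"] smooth_has_vector_derivative[OF assms] by simp
  show "higher_deriv k (higher_deriv 1 f) = higher_deriv (Suc k) f"
    by (simp add: higher_deriv_Suc' higher_deriv_Suc)
qed

lemma smooth_antiderivative:
  assumes "\<And>x. (g has_vector_derivative f x) (at x)" "smooth f"
  shows "smooth g" "higher_deriv (Suc k) g = higher_deriv k f"
proof -
  define F where "F k = (case k of 0 \<Rightarrow> g | Suc j \<Rightarrow> higher_deriv j f)" for k
  have F: "(F k has_vector_derivative F (Suc k) x) (at x)" for k x
    using assms smooth_has_vector_derivative by (auto simp: F_def split: nat.split)
  show "smooth g" using smooth_chain[of F, OF F] by (simp add: F_def)
  show "higher_deriv (Suc k) g = higher_deriv k f"
    using higher_deriv_chain[of F "Suc k", OF F] by (simp add: F_def)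
qed

lemma
  assumes "smooth f" "smooth g"
  shows smooth_add: "smooth (\<lambda>x. f x + g x)"
    and higher_deriv_add: "higher_deriv k (\<lambda>x. f x + g x) = (\<lambda>x. higher_deriv k f x + higher_deriv k g x)"
proof -
  define F where "F k = (\<lambda>x. higher_deriv k f x + higher_deriv k g x)" for k
  have F: "(F k has_vector_derivative F (Suc k) x) (at x)" for k x
    unfolding F_def by (intro derivative_intros smooth_has_vector_derivative assms)
  show "smooth (\<lambda>x. f x + g x)" using smooth_chain[of F, OF F] by (simp add: F_def)
  show "higher_deriv k (\<lambda>x. f x + g x) = (\<lambda>x. higher_deriv k f x + higher_deriv k g x)"
    using higher_deriv_chain[of F k, OF F] by (simp add: F_def)
qed

lemma
  assumes "smooth f"
  shows smooth_cmult: "smooth (\<lambda>x. c * f x)"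
    and higher_deriv_cmult: "higher_deriv k (\<lambda>x. c * f x) = (\<lambda>x. c * higher_deriv k f x)"
proof -
  define F where "F k = (\<lambda>x. c * higher_deriv k f x)" for k
  have F: "(F k has_vector_derivative F (Suc k) x) (at x)" for k x
    unfolding F_def
    by (auto intro!: derivative_eq_intros smooth_has_vector_derivative assms)
  show "smooth (\<lambda>x. c * f x)" using smooth_chain[of F, OF F] by (simp add: F_def)
  show "higher_deriv k (\<lambda>x. c * f x) = (\<lambda>x. c * higher_deriv k f x)"
    using higher_deriv_chain[of F k, OF F] by (simp add: F_def)
qed

lemma smooth_diff: "smooth f \<Longrightarrow> smooth g \<Longrightarrow> smooth (\<lambda>x. f x - g x)"
  using smooth_add[of f "\<lambda>x. -1 * g x"] smooth_cmult[of g "-1"] by simp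

lemma higher_deriv_diff:
  "smooth f \<Longrightarrow> smooth g \<Longrightarrow>
    higher_deriv k (\<lambda>x. f x - g x) = (\<lambda>x. higher_deriv k f x - higher_deriv k g x)"
  using higher_deriv_add[OF _ smooth_cmult[of g "-1"], of f k] higher_deriv_cmult[of g k "-1"]
  by (simp add: fun_eq_iff)

lemma
  shows smooth_exp: "smooth (\<lambda>x. exp (c * of_real x))"
    and higher_deriv_exp: "higher_deriv k (\<lambda>x. exp (c * of_real x)) = (\<lambda>x. c ^ k * exp (c * of_real x))"
proof -
  define F where "F k = (\<lambda>x. c ^ k * exp (c * of_real x))" for k
  have F: "(F k has_vector_derivative F (Suc k) x) (at x)" for k x
    unfolding F_def
    by (auto intro!: derivative_eq_intros has_vector_derivative_real_field simp: mult_ac)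
  show "smooth (\<lambda>x. exp (c * of_real x))" using smooth_chain[of F, OF F] by (simp add: F_def)
  show "higher_deriv k (\<lambda>x. exp (c * of_real x)) = (\<lambda>x. c ^ k * exp (c * of_real x))"
    using higher_deriv_chain[of F k, OF F] by (simp add: F_def)
qed

lemma smooth_const: "smooth (\<lambda>x. c)"
  using smooth_cmult[OF smooth_exp[of 0], of c] by simp

lemma higher_deriv_const: "higher_deriv k (\<lambda>x. c) = (\<lambda>x. if k = 0 then c else 0)"
  using higher_deriv_cmult[OF smooth_exp[of 0], of k c] higher_deriv_exp[of k 0] by (auto simp: fun_eq_iff)

lemma
  fixes r s :: real
  assumes "smooth f"
  shows smooth_affine: "smooth (\<lambda>x. f (r * x + s))"
    and higher_deriv_affine:
      "higher_deriv k (\<lambda>x. f (r * x + s)) = (\<lambda>x. of_real r ^ k * higher_deriv k f (r * x + s))"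
proof -
  define F where "F k = (\<lambda>x. of_real r ^ k * higher_deriv k f (r * x + s))" for k
  have F: "(F k has_vector_derivative F (Suc k) x) (at x)" for k x
  proof -
    have "((\<lambda>x. r * x + s) has_real_derivative r) (at x)"
      by (auto intro!: derivative_eq_intros)
    then have "(higher_deriv k f \<circ> (\<lambda>x. r * x + s) has_vector_derivative
        r *\<^sub>R higher_deriv (Suc k) f (r * x + s)) (at x)"
      by (intro vector_diff_chain_at smooth_has_vector_derivative assms)
         (simp add: has_real_derivative_iff_has_vector_derivative)
    then have "((\<lambda>x. of_real r ^ k * (higher_deriv k f \<circ> (\<lambda>x. r * x + s)) x) has_vector_derivative
       of_real r ^ k * (r *\<^sub>R higher_deriv (Suc k) f (r * x + s))) (at x)"
      by (intro has_vector_derivative_mult_right)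
    then show ?thesis by (simp add: F_def o_def scaleR_conv_of_real mult_ac)
  qed
  show "smooth (\<lambda>x. f (r * x + s))" using smooth_chain[of F, OF F] by (simp add: F_def)
  show "higher_deriv k (\<lambda>x. f (r * x + s)) = (\<lambda>x. of_real r ^ k * higher_deriv k f (r * x + s))"
    using higher_deriv_chain[of F k, OF F] by (simp add: F_def)
qed

lemma
  assumes f: "smooth f" and g: "smooth g"
  shows smooth_mult: "smooth (\<lambda>x. f x * g x)"
    and higher_deriv_mult: "higher_deriv k (\<lambda>x. f x * g x) =
      (\<lambda>x. \<Sum>i\<le>k. of_nat (k choose i) * (higher_deriv i f x * higher_deriv (k - i) g x))"
proof -
  define F where "F k = (\<lambda>x. \<Sum>i\<le>k. of_nat (k choose i) *
      (higher_deriv i f x * higher_deriv (k - i) g x))" for k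
  have F: "(F k has_vector_derivative F (Suc k) x) (at x)" for k x
  proof -
    let ?f = "\<lambda>i. higher_deriv i f x" and ?g = "\<lambda>i. higher_deriv i g x"
    have "(F k has_vector_derivative (\<Sum>i\<le>k. of_nat (k choose i) *
        (?f i * ?g (Suc (k - i)) + ?f (Suc i) * ?g (k - i)))) (at x)"
      unfolding F_def
      by (intro has_vector_derivative_sum has_vector_derivative_mult_right
          has_vector_derivative_mult smooth_has_vector_derivative f g)
    also have "(\<Sum>i\<le>k. of_nat (k choose i) *
        (?f i * ?g (Suc (k - i)) + ?f (Suc i) * ?g (k - i))) = F (Suc k) x"
    proof -
      have "F (Suc k) x = ?f 0 * ?g (Suc k) +
          (\<Sum>i\<le>k. of_nat (Suc k choose Suc i) * (?f (Suc i) * ?g (k - i)))"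
        unfolding F_def by (subst sum.atMost_Suc_shift) simp
      also have "(\<Sum>i\<le>k. of_nat (Suc k choose Suc i) * (?f (Suc i) * ?g (k - i))) =
          (\<Sum>i\<le>k. of_nat (k choose i) * (?f (Suc i) * ?g (k - i))) +
          (\<Sum>i\<le>k. of_nat (k choose Suc i) * (?f (Suc i) * ?g (k - i)))"
        by (simp add: sum.distrib distrib_right)
      also have "?f 0 * ?g (Suc k) + (\<dots>) = (\<Sum>i\<le>k. of_nat (k choose i) * (?f (Suc i) * ?g (k - i))) +
          (?f 0 * ?g (Suc k) + (\<Sum>i\<le>k. of_nat (k choose Suc i) * (?f (Suc i) * ?g (k - i))))"
        by (simp add: add_ac)
      also have "?f 0 * ?g (Suc k) + (\<Sum>i\<le>k. of_nat (k choose Suc i) * (?f (Suc i) * ?g (k - i)))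
         = (\<Sum>i\<le>Suc k. of_nat (k choose i) * (?f i * ?g (Suc k - i)))"
        by (subst sum.atMost_Suc_shift) simp
      also have "\<dots> = (\<Sum>i\<le>k. of_nat (k choose i) * (?f i * ?g (Suc (k - i))))"
        by (simp add: Suc_diff_le)
      finally show ?thesis
        by (simp add: sum.distrib distrib_left)
    qed
    finally show ?thesis .
  qed
  show "smooth (\<lambda>x. f x * g x)" using smooth_chain[of F, OF F] by (simp add: F_def)
  show "higher_deriv k (\<lambda>x. f x * g x) =
      (\<lambda>x. \<Sum>i\<le>k. of_nat (k choose i) * (higher_deriv i f x * higher_deriv (k - i) g x))"
    using higher_deriv_chain[of F k, OF F] by (simp add: F_def)
qed

text \<open>The bound is pointwise, so that \<open>A = 0\<close> is available at the points where \<open>f\<close> vanishes to all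
orders. It comes from the Leibniz formula, whose binomial coefficients add up to \<open>2^k\<close>.\<close>
lemma higher_deriv_mult_bound:
  assumes "smooth f" "smooth g"
    and "\<And>j. j \<le> k \<Longrightarrow> norm (higher_deriv j f x) \<le> A"
    and "\<And>j. j \<le> k \<Longrightarrow> norm (higher_deriv j g x) \<le> B"
  shows "norm (higher_deriv k (\<lambda>x. f x * g x) x) \<le> 2 ^ k * (A * B)"
proof -
  have "0 \<le> A" using assms(3)[of 0] norm_ge_zero order_trans by blast
  have "norm (higher_deriv k (\<lambda>x. f x * g x) x) \<le> (\<Sum>i\<le>k. real (k choose i) * (A * B))"
    unfolding higher_deriv_mult[OF assms(1,2)]
    by (intro sum_norm_le) (simp add: norm_mult mult_left_mono mult_mono assms(3,4) \<open>0 \<le> A\<close>)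
  also have "\<dots> = 2 ^ k * (A * B)"
    using choose_row_sum[of k] by (simp add: sum_distrib_right[symmetric] flip: of_nat_sum)
  finally show ?thesis .
qed

lemma higher_deriv_cong_open:
  assumes "open U" "\<And>x. x \<in> U \<Longrightarrow> f x = g x" "x \<in> U"
  shows "higher_deriv k f x = higher_deriv k g x"
  using assms(3)
proof (induction k arbitrary: x)
  case (Suc k)
  have "\<forall>\<^sub>F y in nhds x. higher_deriv k f y = higher_deriv k g y"
    using eventually_nhds_in_open[OF assms(1) Suc.prems] by eventually_elim (rule Suc.IH)
  then show ?case
    unfolding higher_deriv_Suc by (intro vector_derivative_cong_eq) auto
qed (use assms in simp)

lemma supp_outside: "f x \<noteq> 0 \<Longrightarrow> x \<in> supp f"
  unfolding supp_def by (intro subsetD[OF closure_subset]) simp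

lemma higher_deriv_outside_supp:
  assumes "x \<notin> supp f" shows "higher_deriv k f x = 0"
proof -
  have "higher_deriv k f x = higher_deriv k (\<lambda>x. 0) x"
  proof (rule higher_deriv_cong_open)
    show "open (- supp f)" by (simp add: supp_def open_Compl)
    show "\<And>x. x \<in> - supp f \<Longrightarrow> f x = 0"
      using supp_outside by auto
  qed (use assms in simp)
  then show ?thesis by (simp add: higher_deriv_const)
qed

lemma supp_subset: "closed K \<Longrightarrow> (\<And>x. x \<notin> K \<Longrightarrow> f x = 0) \<Longrightarrow> supp f \<subseteq> K"
  unfolding supp_def by (intro closure_minimal) auto

lemma test_funI:
  assumes "smooth f" "\<And>x. R < \<bar>x\<bar> \<Longrightarrow> f x = 0" shows "test_fun f"
proof -
  have "supp f \<subseteq> {-R..R}" using assms(2) by (intro supp_subset) (auto simp: abs_le_iff)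
  then have "compact (supp f)"
    by (metis closed_closure compact_Icc compact_Int_closed inf.absorb_iff2 supp_def)
  then show ?thesis using assms(1) by (simp add: test_fun_def)
qed

lemma compact_real_bounded:
  assumes "compact (K :: real set)" obtains R where "R > 0" "K \<subseteq> {-R..R}"
proof -
  obtain R where "R > 0" "\<And>x. x \<in> K \<Longrightarrow> norm x \<le> R"
    using compact_imp_bounded[OF assms] by (auto simp: bounded_pos)
  then show ?thesis by (intro that[of R]) (force simp: abs_le_iff)+
qed

lemma test_funE:
  assumes "test_fun f" obtains R where "R > 0" "supp f \<subseteq> {-R..R}" "\<forall>x. R < \<bar>x\<bar> \<longrightarrow> f x = 0"
proof -
  obtain R where R: "R > 0" "supp f \<subseteq> {-R..R}"
    using assms compact_real_bounded unfolding test_fun_def by blast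
  then have "R < \<bar>x\<bar> \<Longrightarrow> f x = 0" for x
    using supp_outside[of f x] by (force simp: subset_iff)
  then show ?thesis using R that by blast
qed

lemma test_fun_smooth: "test_fun f \<Longrightarrow> smooth f"
  by (simp add: test_fun_def)

lemma test_fun_add: assumes "test_fun f" "test_fun g" shows "test_fun (\<lambda>x. f x + g x)"
proof -
  obtain R where "\<forall>x. R < \<bar>x\<bar> \<longrightarrow> f x = 0"
    by (rule test_funE[OF assms(1)]) blast
  moreover obtain S where "\<forall>x. S < \<bar>x\<bar> \<longrightarrow> g x = 0"
    by (rule test_funE[OF assms(2)]) blast
  ultimately show ?thesis
    using assms by (intro test_funI[of _ "max R S"] smooth_add) (auto simp: test_fun_def)
qed

lemma test_fun_mult: assumes "test_fun f" "smooth g" shows "test_fun (\<lambda>x. f x * g x)"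
proof -
  obtain R where "\<forall>x. R < \<bar>x\<bar> \<longrightarrow> f x = 0"
    by (rule test_funE[OF assms(1)]) blast
  then show ?thesis
    using assms by (intro test_funI[of _ R] smooth_mult) (auto simp: test_fun_def)
qed

lemma test_fun_cmult: "test_fun f \<Longrightarrow> test_fun (\<lambda>x. c * f x)"
  using test_fun_mult[OF _ smooth_const[of c]] by (simp add: mult.commute)

lemma test_fun_diff: "test_fun f \<Longrightarrow> test_fun g \<Longrightarrow> test_fun (\<lambda>x. f x - g x)"
  using test_fun_add[of f "\<lambda>x. -1 * g x"] test_fun_cmult[of g "-1"] by simp

lemma test_fun_affine:
  assumes "test_fun f" "r \<noteq> 0" shows "test_fun (\<lambda>x. f (r * x + s))"
proof -
  obtain R where R: "\<forall>x. R < \<bar>x\<bar> \<longrightarrow> f x = 0"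
    by (rule test_funE[OF assms(1)]) blast
  have "f (r * x + s) = 0" if "(R + \<bar>s\<bar>) / \<bar>r\<bar> < \<bar>x\<bar>" for x
  proof -
    have "R + \<bar>s\<bar> < \<bar>r * x\<bar>"
      using that assms(2) by (simp add: abs_mult pos_divide_less_eq mult.commute)
    then have "R < \<bar>r * x + s\<bar>" by linarith
    then show ?thesis using R by blast
  qed
  then show ?thesis
    by (rule test_funI[OF smooth_affine[OF test_fun_smooth[OF assms(1)]]])
qed

lemma test_fun_deriv_bounded:
  assumes "test_fun f" obtains B where "\<And>x. norm (higher_deriv k f x) \<le> B"
proof -
  have "compact (higher_deriv k f ` supp f)"
    using assms smooth_imp_continuous_on unfolding test_fun_def by (intro compact_continuous_image) auto
  then obtain B where B: "B > 0" "\<And>x. x \<in> supp f \<Longrightarrow> norm (higher_deriv k f x) \<le> B"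
    using compact_imp_bounded by (force simp: bounded_pos)
  have "norm (higher_deriv k f x) \<le> B" for x
    using B higher_deriv_outside_supp[of x f k] by (cases "x \<in> supp f") auto
  then show ?thesis using that by blast
qed

section \<open>Cutoff functions and separation of continuous functions\<close>

lemma poly_times_exp_neg_tendsto_0:
  "((\<lambda>y. poly p y * exp (- y)) \<longlongrightarrow> (0::real)) at_top"
proof -
  have "((\<lambda>y. \<Sum>i\<le>degree p. coeff p i * (y ^ i / exp y)) \<longlongrightarrow> (\<Sum>i\<le>degree p. coeff p i * 0)) at_top"
    by (intro tendsto_sum tendsto_mult tendsto_const tendsto_power_div_exp_0)
  then show ?thesis
    by (simp add: poly_altdef exp_minus sum_distrib_right divide_inverse mult.assoc)
qed

text \<open>The functions \<open>q(1/x) e^(-1/x)\<close>, continued by 0, form a class closed under differentiation. This is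
why \<open>e^(-1/x)\<close> is smooth at 0.\<close>
definition flat :: "real poly \<Rightarrow> real \<Rightarrow> real" where
  "flat q x = (if 0 < x then poly q (1 / x) * exp (- (1 / x)) else 0)"

lemma flat_has_derivative:
  "(flat q has_real_derivative flat ([:0, 0, 1:] * (q - pderiv q)) x) (at x)"
proof (cases x "0 :: real" rule: linorder_cases)
  case less
  have "((\<lambda>x. 0) has_real_derivative flat ([:0, 0, 1:] * (q - pderiv q)) x) (at x)"
    using less by (simp add: flat_def)
  then show ?thesis
    by (rule has_field_derivative_transform_within_open[of _ _ _ "{..<0}"]) (use less in \<open>auto simp: flat_def\<close>)
next
  case equal
  have "((\<lambda>y. flat q y / y) \<longlongrightarrow> 0) (at_right 0)"
  proof -
    have "((\<lambda>x. poly (pCons 0 q) (inverse x) * exp (- inverse x)) \<longlongrightarrow> (0::real)) (at_right 0)"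
      using filterlim_compose[OF poly_times_exp_neg_tendsto_0 filterlim_inverse_at_top_right] .
    moreover have "\<forall>\<^sub>F x in at_right 0.
        flat q x / x = poly (pCons 0 q) (inverse x) * exp (- inverse x)"
      by (auto simp: eventually_at_filter flat_def field_simps)
    ultimately show ?thesis by (simp only: tendsto_cong)
  qed
  moreover have "((\<lambda>y. flat q y / y) \<longlongrightarrow> 0) (at_left 0)"
  proof -
    have "\<forall>\<^sub>F x in at_left 0. flat q x / x = 0"
      by (auto simp: eventually_at_filter flat_def)
    then show ?thesis by (rule tendsto_eventually)
  qed
  ultimately have "((\<lambda>y. flat q y / y) \<longlongrightarrow> 0) (at 0)"
    by (simp add: filterlim_split_at)
  then show ?thesis
    using equal by (simp add: has_field_derivative_iff flat_def)
next
  case greater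
  have "((\<lambda>x. poly q (1 / x) * exp (- (1 / x))) has_real_derivative
      flat ([:0, 0, 1:] * (q - pderiv q)) x) (at x)"
    using greater
    by (auto intro!: derivative_eq_intros DERIV_chain2[OF poly_DERIV]
        simp: flat_def field_simps power2_eq_square)
  then show ?thesis
    by (rule has_field_derivative_transform_within_open[of _ _ _ "{0<..}"])
       (use greater in \<open>auto simp: flat_def\<close>)
qed

lemma smooth_of_real_antiderivative:
  assumes "\<And>x. (g has_real_derivative f x) (at x)" "smooth (\<lambda>x. of_real (f x))"
  shows "smooth (\<lambda>x. of_real (g x))"
proof (rule smooth_antiderivative(1)[OF _ assms(2)])
  show "((\<lambda>x. of_real (g x)) has_vector_derivative complex_of_real (f x)) (at x)" for x
    using assms(1) by (intro has_vector_derivative_of_real)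
      (simp add: has_real_derivative_iff_has_vector_derivative)
qed

lemma smooth_flat: "smooth (\<lambda>x. of_real (flat q x))"
proof -
  define F where "F k = (\<lambda>x. of_real (flat (((\<lambda>q. [:0, 0, 1:] * (q - pderiv q)) ^^ k) q) x) :: complex)" for k
  have "(F k has_vector_derivative F (Suc k) x) (at x)" for k x
    unfolding F_def using flat_has_derivative
    by (intro has_vector_derivative_of_real) (simp add: has_real_derivative_iff_has_vector_derivative)
  then show ?thesis
    using smooth_chain[of F] by (simp add: F_def)
qed

definition bump :: "real \<Rightarrow> real" where
  "bump x = flat 1 x * flat 1 (1 - x)"

lemma bump_nonneg: "0 \<le> bump x"
  by (simp add: bump_def flat_def)

lemma bump_pos: "0 < x \<Longrightarrow> x < 1 \<Longrightarrow> 0 < bump x"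
  by (simp add: bump_def flat_def)

lemma bump_outside: "x \<le> 0 \<or> 1 \<le> x \<Longrightarrow> bump x = 0"
  by (auto simp: bump_def flat_def)

lemma smooth_bump: "smooth (\<lambda>x. of_real (bump x))"
  using smooth_mult[OF smooth_flat smooth_affine[OF smooth_flat, of 1 "-1" 1], of 1]
  by (simp add: bump_def)

lemma continuous_on_bump: "continuous_on A bump"
proof -
  have "continuous_on A (\<lambda>x. Re (of_real (bump x)))"
    using smooth_imp_continuous_on[OF smooth_bump, of A 0] by (intro continuous_on_Re) simp
  then show ?thesis by simp
qed

text \<open>A normalised primitive of \<open>bump\<close>.\<close>
lemma smooth_step_exists:
  obtains \<sigma> where "smooth \<sigma>" "\<forall>x\<le>0. \<sigma> x = 0" "\<forall>x\<ge>1. \<sigma> x = 1"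
proof -
  have "\<exists>F. \<forall>x. - \<infinity> < ereal x \<longrightarrow> ereal x < \<infinity> \<longrightarrow> (F has_vector_derivative bump x) (at x)"
    using continuous_on_bump[of UNIV] by (intro einterval_antiderivative) (auto simp: continuous_on_eq_continuous_at)
  then obtain S where S: "\<And>x. (S has_real_derivative bump x) (at x)"
    by (auto simp: has_real_derivative_iff_has_vector_derivative)
  have "S 0 < S 1"
    by (rule DERIV_pos_imp_increasing_open[of 0 1])
       (use S bump_pos in \<open>auto intro!: continuous_at_imp_continuous_on DERIV_isCont\<close>)
  have const: "\<exists>c. \<forall>x\<in>A. S x = c" if "convex A" "\<And>x. x \<in> A \<Longrightarrow> bump x = 0" for A
    using that S by (intro has_field_derivative_zero_constant) (metis has_field_derivative_at_within)+
  have S0: "S x = S 0" if "x \<le> 0" for x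
    using that const[of "{..0}"] bump_outside by auto
  have S1: "S x = S 1" if "1 \<le> x" for x
    using that const[of "{1..}"] bump_outside by auto
  define \<sigma> where "\<sigma> x = of_real (1 / (S 1 - S 0)) * (complex_of_real (S x) - of_real (S 0))" for x
  show ?thesis
  proof
    show "smooth \<sigma>"
      unfolding \<sigma>_def
      by (rule smooth_cmult[OF smooth_diff[OF smooth_of_real_antiderivative[OF S smooth_bump] smooth_const]])
    have "\<sigma> x = 0" if "x \<le> 0" for x
      unfolding \<sigma>_def S0[OF that] by simp
    then show "\<forall>x\<le>0. \<sigma> x = 0" by blast
    have "\<sigma> x = 1" if "1 \<le> x" for x
      unfolding \<sigma>_def S1[OF that] using \<open>S 0 < S 1\<close> by (simp add: field_simps)
    then show "\<forall>x\<ge>1. \<sigma> x = 1" by blast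
  qed
qed

lemma cutoff_exists:
  obtains \<eta> where "test_fun \<eta>" "\<forall>x. \<bar>x\<bar> \<le> R \<longrightarrow> \<eta> x = 1"
proof -
  obtain \<sigma> where \<sigma>: "smooth \<sigma>" "\<forall>x\<le>0. \<sigma> x = 0" "\<forall>x\<ge>1. \<sigma> x = 1"
    using smooth_step_exists by blast
  \<comment> \<open>the explicit coefficients 1 and -1 put both factors into the form of \<open>smooth_affine\<close>\<close>
  define \<eta> where "\<eta> x = \<sigma> (1 * x + (R + 1)) * \<sigma> (-1 * x + (R + 1))" for x
  show ?thesis
  proof
    show "test_fun \<eta>"
    proof (rule test_funI)
      show "smooth \<eta>"
        unfolding \<eta>_def by (rule smooth_mult[OF smooth_affine[OF \<sigma>(1)] smooth_affine[OF \<sigma>(1)]])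
      show "\<eta> x = 0" if "R + 1 < \<bar>x\<bar>" for x
        using that \<sigma>(2)[rule_format, of "x + (R + 1)"] \<sigma>(2)[rule_format, of "-x + (R + 1)"]
        by (auto simp: \<eta>_def abs_if split: if_splits)
    qed
    show "\<forall>x. \<bar>x\<bar> \<le> R \<longrightarrow> \<eta> x = 1"
      by (auto simp: \<eta>_def \<sigma>(3) abs_le_iff)
  qed
qed

lemma integrable_continuous_bounded_support:
  fixes f :: "real \<Rightarrow> 'b :: {banach, second_countable_topology}"
  assumes "continuous_on UNIV f" "\<And>x. R < \<bar>x\<bar> \<Longrightarrow> f x = 0"
  shows "integrable lborel f"
proof -
  have "integrable lborel (\<lambda>x. indicator {-R..R} x *\<^sub>R f x)"
    by (intro borel_integrable_compact continuous_on_subset[OF assms(1)]) auto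
  also have "(\<lambda>x. indicator {-R..R} x *\<^sub>R f x) = f"
    using assms(2) by (auto simp: fun_eq_iff indicator_def)
  finally show ?thesis .
qed

lemma integral_pos_continuous_nonneg:
  fixes f :: "real \<Rightarrow> real"
  assumes "continuous_on UNIV f" "\<And>x. R < \<bar>x\<bar> \<Longrightarrow> f x = 0" "\<And>x. 0 \<le> f x" "0 < f y"
  shows "(LINT x|lborel. f x) > 0"
proof -
  define S where "S = max R \<bar>y\<bar> + 1"
  have "(f has_integral (LINT x|lborel. f x)) UNIV"
    by (intro has_integral_integral_lborel integrable_continuous_bounded_support[OF assms(1)])
       (use assms(2) in auto)
  moreover have "f = (\<lambda>x. if x \<in> cbox (-S) S then f x else 0)"
    using assms(2) by (force simp: S_def)
  ultimately have "((\<lambda>x. if x \<in> cbox (-S) S then f x else 0) has_integral (LINT x|lborel. f x)) UNIV"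
    by simp
  then have *: "(f has_integral (LINT x|lborel. f x)) (cbox (-S) S)"
    by (simp only: has_integral_restrict_UNIV)
  have "(LINT x|lborel. f x) \<noteq> 0"
  proof
    assume 0: "(LINT x|lborel. f x) = 0"
    have "f y = 0"
      by (rule has_integral_0_cbox_imp_0[of "-S" S f])
         (use assms * 0 in \<open>auto simp: S_def intro: continuous_on_subset\<close>)
    with assms(4) show False by simp
  qed
  moreover have "(LINT x|lborel. f x) \<ge> 0"
    using assms(3) by (intro integral_nonneg_AE) auto
  ultimately show ?thesis by simp
qed

text \<open>If \<open>h y \<noteq> 0\<close>, then \<open>Re (h x * cnj (h y))\<close> is positive near \<open>y\<close>. Testing with \<open>cnj (h y)\<close> times a
narrow bump at \<open>y\<close> gives an integral with positive real part.\<close>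
lemma regular_dist_separates:
  assumes cont: "continuous_on UNIV h"
    and null: "\<And>g. test_fun g \<Longrightarrow> (\<And>x. r \<le> \<bar>x\<bar> \<Longrightarrow> g x = 0) \<Longrightarrow> regular_dist h g = 0"
    and y: "\<bar>y\<bar> < r"
  shows "h y = 0"
proof (rule ccontr)
  assume "h y \<noteq> 0"
  define k where "k x = Re (h x * cnj (h y))" for x
  have k: "continuous_on UNIV k"
    unfolding k_def by (intro continuous_intros cont)
  have "k y > 0"
    using \<open>h y \<noteq> 0\<close> by (simp add: k_def complex_eq_iff sum_power2_gt_zero_iff flip: power2_eq_square)
  moreover have "open {x. 0 < k x}"
    by (intro open_Collect_less continuous_on_const k)
  ultimately obtain e where e: "e > 0" "\<And>x. \<bar>x - y\<bar> < e \<Longrightarrow> k x > 0"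
    unfolding open_dist by (auto simp: dist_real_def)
  define \<delta> where "\<delta> = min e (r - \<bar>y\<bar>)"
  have \<delta>: "\<delta> > 0" "\<delta> \<le> e" "\<delta> \<le> r - \<bar>y\<bar>"
    using e y by (auto simp: \<delta>_def)
  define b where "b x = bump (1 / (2 * \<delta>) * x + (1/2 - y / (2 * \<delta>)))" for x
  have b_eq: "b x = bump ((x - y + \<delta>) / (2 * \<delta>))" for x
    using \<delta> by (simp add: b_def field_simps)
  have b0: "b x = 0" if "\<delta> \<le> \<bar>x - y\<bar>" for x
    unfolding b_eq using that \<delta> by (intro bump_outside) (auto simp: field_simps abs_if split: if_splits)
  have b1: "b y > 0"
    unfolding b_eq using \<delta> by (intro bump_pos) auto
  have b_smooth: "smooth (\<lambda>x. of_real (b x))"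
    unfolding b_def using smooth_affine[OF smooth_bump] .
  have b_cont: "continuous_on UNIV b"
    unfolding b_def by (intro continuous_on_compose2[OF continuous_on_bump[of UNIV]] continuous_intros) auto
  have out: "b x = 0" if "r \<le> \<bar>x\<bar>" for x
    using that \<delta> by (intro b0) linarith
  have "regular_dist h (\<lambda>x. cnj (h y) * of_real (b x)) = 0"
    by (intro null test_fun_cmult test_funI[OF b_smooth, of r]) (use out in auto)
  then have "(LINT x|lborel. h x * (cnj (h y) * of_real (b x))) = 0"
    by (simp add: regular_dist_def)
  then have "Re (LINT x|lborel. h x * (cnj (h y) * of_real (b x))) = 0"
    by simp
  moreover have int: "integrable lborel (\<lambda>x. h x * (cnj (h y) * of_real (b x)))"
    by (rule integrable_continuous_bounded_support[of _ r])
       (use out in \<open>auto intro!: continuous_intros cont b_cont\<close>)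
  ultimately have "(LINT x|lborel. Re (h x * (cnj (h y) * of_real (b x)))) = 0"
    by (simp only: integral_Re[OF int])
  moreover have "(LINT x|lborel. Re (h x * (cnj (h y) * of_real (b x)))) > 0"
  proof (rule integral_pos_continuous_nonneg[of _ r])
    have *: "Re (h x * (cnj (h y) * of_real (b x))) = k x * b x" for x
      by (simp add: k_def algebra_simps)
    show "continuous_on UNIV (\<lambda>x. Re (h x * (cnj (h y) * of_real (b x))))"
      unfolding * by (intro continuous_intros k b_cont)
    show "0 < Re (h y * (cnj (h y) * of_real (b y)))"
      unfolding * using b1 \<open>k y > 0\<close> by simp
    show "0 \<le> Re (h x * (cnj (h y) * of_real (b x)))" for x
      unfolding * using b0[of x] e(2)[of x] \<delta> bump_nonneg
      by (cases "\<bar>x - y\<bar> < \<delta>") (auto simp: b_def intro!: mult_nonneg_nonneg)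
  qed (use out in auto)
  ultimately show False by simp
qed

section \<open>Distributions, supports and the Fourier transform\<close>

lemma distribution_plus:
  "distribution u \<Longrightarrow> test_fun f \<Longrightarrow> test_fun g \<Longrightarrow> u (\<lambda>x. f x + g x) = u f + u g"
  by (simp add: distribution_def)

lemma distribution_times: "distribution u \<Longrightarrow> test_fun f \<Longrightarrow> u (\<lambda>x. c * f x) = c * u f"
  by (simp add: distribution_def)

lemma distribution_minus:
  assumes "distribution u" "test_fun f" "test_fun g"
  shows "u (\<lambda>x. f x - g x) = u f - u g"
  using distribution_plus[OF assms(1,2) test_fun_cmult[OF assms(3), of "-1"]]
    distribution_times[OF assms(1,3), of "-1"] by simp

text \<open>Uniform bounds on all derivatives up to order \<open>m\<close> are easier to combine than sums of suprema. This
lemma and \<open>distributionI\<close> translate between the two forms of continuity.\<close>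
lemma distribution_bound:
  assumes "distribution u"
  obtains B m where "0 \<le> B"
    "\<forall>f M. test_fun f \<longrightarrow> (\<forall>x. R < \<bar>x\<bar> \<longrightarrow> f x = 0) \<longrightarrow>
       (\<forall>k\<le>m. \<forall>x. norm (higher_deriv k f x) \<le> M) \<longrightarrow> norm (u f) \<le> B * M"
proof -
  obtain B m where Bm: "\<forall>f. test_fun f \<and> supp f \<subseteq> {-R..R} \<longrightarrow>
        norm (u f) \<le> B * (\<Sum>k\<le>m. SUP x. norm (higher_deriv k f x))"
    using assms unfolding distribution_def by (meson compact_Icc)
  have "norm (u f) \<le> (\<bar>B\<bar> * real (Suc m)) * M"
    if f: "test_fun f" "\<forall>x. R < \<bar>x\<bar> \<longrightarrow> f x = 0"
      and M: "\<forall>k\<le>m. \<forall>x. norm (higher_deriv k f x) \<le> M" for f M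
  proof -
    have "supp f \<subseteq> {-R..R}"
      using f(2) by (intro supp_subset) (auto simp: abs_le_iff)
    then have "norm (u f) \<le> B * (\<Sum>k\<le>m. SUP x. norm (higher_deriv k f x))"
      using Bm f(1) by blast
    also have "\<dots> \<le> \<bar>B\<bar> * (\<Sum>k\<le>m. M)"
    proof (rule mult_mono)
      show "(\<Sum>k\<le>m. SUP x. norm (higher_deriv k f x)) \<le> (\<Sum>k\<le>m. M)"
        using M by (intro sum_mono cSUP_least) auto
      show "0 \<le> (\<Sum>k\<le>m. SUP x. norm (higher_deriv k f x))"
      proof (rule sum_nonneg)
        fix k assume "k \<in> {..m}"
        then have "bdd_above (range (\<lambda>x. norm (higher_deriv k f x)))"
          using M by (intro bdd_aboveI[of _ M]) auto
        then show "0 \<le> (SUP x. norm (higher_deriv k f x))"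
          using cSUP_upper[of 0 UNIV "\<lambda>x. norm (higher_deriv k f x)"] norm_ge_zero order_trans by blast
      qed
    qed auto
    finally show ?thesis by (simp add: mult.assoc)
  qed
  then show ?thesis
    using that[of "\<bar>B\<bar> * real (Suc m)" m] by simp
qed

lemma distributionI:
  assumes "\<And>f g. test_fun f \<Longrightarrow> test_fun g \<Longrightarrow> u (\<lambda>x. f x + g x) = u f + u g"
    and "\<And>c f. test_fun f \<Longrightarrow> u (\<lambda>x. c * f x) = c * u f"
    and "\<And>R. \<exists>B m. 0 \<le> B \<and> (\<forall>f M. test_fun f \<longrightarrow> (\<forall>x. R < \<bar>x\<bar> \<longrightarrow> f x = 0) \<longrightarrow>
       (\<forall>k\<le>m. \<forall>x. norm (higher_deriv k f x) \<le> M) \<longrightarrow> norm (u f) \<le> B * M)"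
  shows "distribution u"
  unfolding distribution_def
proof (intro conjI allI impI)
  fix K :: "real set" assume "compact K"
  then obtain R where R: "K \<subseteq> {-R..R}"
    using compact_real_bounded by blast
  obtain B m where B: "0 \<le> B" "\<forall>f M. test_fun f \<longrightarrow> (\<forall>x. R < \<bar>x\<bar> \<longrightarrow> f x = 0) \<longrightarrow>
       (\<forall>k\<le>m. \<forall>x. norm (higher_deriv k f x) \<le> M) \<longrightarrow> norm (u f) \<le> B * M"
    using assms(3) by blast
  have "norm (u f) \<le> B * (\<Sum>k\<le>m. SUP x. norm (higher_deriv k f x))"
    if f: "test_fun f" "supp f \<subseteq> K" for f
  proof -
    have bdd: "bdd_above (range (\<lambda>x. norm (higher_deriv k f x)))" for k
      using test_fun_deriv_bounded[OF f(1), of k] by (metis bdd_aboveI2)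
    have "norm (higher_deriv k f x) \<le> (SUP x. norm (higher_deriv k f x))" for k x
      by (rule cSUP_upper[OF _ bdd]) simp
    moreover have "0 \<le> (SUP x. norm (higher_deriv k f x))" for k
      using calculation[of k 0] norm_ge_zero order_trans by blast
    ultimately have "norm (higher_deriv k f x) \<le> (\<Sum>k\<le>m. SUP x. norm (higher_deriv k f x))"
      if "k \<le> m" for k x
      using member_le_sum[of k "{..m}" "\<lambda>k. SUP x. norm (higher_deriv k f x)"] that
      by (meson atMost_iff finite_atMost order_trans)
    moreover have "f x = 0" if "R < \<bar>x\<bar>" for x
      using that f(2) R supp_outside[of f x] by (force simp: subset_iff)
    ultimately show ?thesis
      using B(2) f(1) by blast
  qed
  then show "\<exists>B m. \<forall>f. test_fun f \<and> supp f \<subseteq> K \<longrightarrow>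
        norm (u f) \<le> B * (\<Sum>k\<le>m. SUP x. norm (higher_deriv k f x))"
    by blast
qed (use assms in blast)+

lemma distribution_affine:
  assumes "distribution u" "r \<noteq> 0"
  shows "distribution (\<lambda>g. u (\<lambda>x. g (r * x + s)))"
proof (rule distributionI)
  fix R
  define R' where "R' = (R + \<bar>s\<bar>) / \<bar>r\<bar>"
  obtain B m where B: "0 \<le> B" "\<forall>f M. test_fun f \<longrightarrow> (\<forall>x. R' < \<bar>x\<bar> \<longrightarrow> f x = 0) \<longrightarrow>
       (\<forall>k\<le>m. \<forall>x. norm (higher_deriv k f x) \<le> M) \<longrightarrow> norm (u f) \<le> B * M"
    using distribution_bound[OF assms(1)] by blast
  define A where "A = max 1 \<bar>r\<bar> ^ m"
  have "norm (u (\<lambda>x. f (r * x + s))) \<le> (B * A) * M"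
    if f: "test_fun f" "\<forall>x. R < \<bar>x\<bar> \<longrightarrow> f x = 0"
      and M: "\<forall>k\<le>m. \<forall>x. norm (higher_deriv k f x) \<le> M" for f M
  proof -
    have "f (r * x + s) = 0" if "R' < \<bar>x\<bar>" for x
    proof -
      have "R + \<bar>s\<bar> < \<bar>r * x\<bar>"
        using that assms(2) by (simp add: R'_def abs_mult pos_divide_less_eq mult.commute)
      then have "R < \<bar>r * x + s\<bar>" by linarith
      then show ?thesis using f(2) by blast
    qed
    moreover have "norm (higher_deriv k (\<lambda>x. f (r * x + s)) x) \<le> A * M" if "k \<le> m" for k x
    proof -
      have "\<bar>r\<bar> ^ k \<le> max 1 \<bar>r\<bar> ^ k" by (intro power_mono) auto
      also have "\<dots> \<le> A" unfolding A_def using that by (intro power_increasing) auto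
      finally show ?thesis
        using M that A_def
        by (auto simp: higher_deriv_affine[OF test_fun_smooth[OF f(1)]] norm_mult norm_power intro!: mult_mono)
    qed
    ultimately have "norm (u (\<lambda>x. f (r * x + s))) \<le> B * (A * M)"
      using B(2) test_fun_affine[OF f(1) assms(2), of s] by blast
    then show ?thesis by (simp add: mult.assoc)
  qed
  moreover have "0 \<le> B * A" using B(1) by (simp add: A_def)
  ultimately show "\<exists>B m. 0 \<le> B \<and> (\<forall>f M. test_fun f \<longrightarrow> (\<forall>x. R < \<bar>x\<bar> \<longrightarrow> f x = 0) \<longrightarrow>
       (\<forall>k\<le>m. \<forall>x. norm (higher_deriv k f x) \<le> M) \<longrightarrow> norm (u (\<lambda>x. f (r * x + s))) \<le> B * M)"
    by blast
qed (auto intro!: distribution_plus[OF assms(1)] distribution_times[OF assms(1)] test_fun_affine assms(2))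

lemma distribution_add:
  assumes "distribution u" "distribution v"
  shows "distribution (\<lambda>g. u g + v g)"
proof (rule distributionI)
  fix R
  obtain B m where B: "0 \<le> B" "\<forall>f M. test_fun f \<longrightarrow> (\<forall>x. R < \<bar>x\<bar> \<longrightarrow> f x = 0) \<longrightarrow>
       (\<forall>k\<le>m. \<forall>x. norm (higher_deriv k f x) \<le> M) \<longrightarrow> norm (u f) \<le> B * M"
    using distribution_bound[OF assms(1)] by blast
  obtain B' m' where B': "0 \<le> B'" "\<forall>f M. test_fun f \<longrightarrow> (\<forall>x. R < \<bar>x\<bar> \<longrightarrow> f x = 0) \<longrightarrow>
       (\<forall>k\<le>m'. \<forall>x. norm (higher_deriv k f x) \<le> M) \<longrightarrow> norm (v f) \<le> B' * M"
    using distribution_bound[OF assms(2)] by blast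
  have "norm (u f + v f) \<le> (B + B') * M"
    if f: "test_fun f" "\<forall>x. R < \<bar>x\<bar> \<longrightarrow> f x = 0"
      and M: "\<forall>k\<le>max m m'. \<forall>x. norm (higher_deriv k f x) \<le> M" for f M
    using norm_triangle_le[of "u f" "v f" "B * M + B' * M"] B(2) B'(2) f M
    by (simp add: distrib_right add_mono)
  then show "\<exists>B m. 0 \<le> B \<and> (\<forall>f M. test_fun f \<longrightarrow> (\<forall>x. R < \<bar>x\<bar> \<longrightarrow> f x = 0) \<longrightarrow>
       (\<forall>k\<le>m. \<forall>x. norm (higher_deriv k f x) \<le> M) \<longrightarrow> norm (u f + v f) \<le> B * M)"
    using B(1) B'(1) add_nonneg_nonneg by blast
qed (simp_all add: distribution_plus distribution_times assms distrib_left)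

lemma distribution_cmult:
  assumes "distribution u"
  shows "distribution (\<lambda>g. c * u g)"
proof (rule distributionI)
  fix R
  obtain B m where B: "0 \<le> B" "\<forall>f M. test_fun f \<longrightarrow> (\<forall>x. R < \<bar>x\<bar> \<longrightarrow> f x = 0) \<longrightarrow>
       (\<forall>k\<le>m. \<forall>x. norm (higher_deriv k f x) \<le> M) \<longrightarrow> norm (u f) \<le> B * M"
    using distribution_bound[OF assms(1)] by blast
  then show "\<exists>B m. 0 \<le> B \<and> (\<forall>f M. test_fun f \<longrightarrow> (\<forall>x. R < \<bar>x\<bar> \<longrightarrow> f x = 0) \<longrightarrow>
       (\<forall>k\<le>m. \<forall>x. norm (higher_deriv k f x) \<le> M) \<longrightarrow> norm (c * u f) \<le> B * M)"
    by (intro exI[of _ "norm c * B"] exI[of _ m]) (auto simp: norm_mult mult.assoc intro!: mult_left_mono)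
qed (simp_all add: distribution_plus distribution_times assms distrib_left mult_ac)

lemma distribution_sum:
  fixes n :: nat
  assumes "\<And>i. distribution (u i)"
  shows "distribution (\<lambda>g. \<Sum>i\<le>n. u i g)"
  by (induction n) (simp_all add: assms distribution_add)

text \<open>Testing with functions that vanish on the open interval, rather than on a neighbourhood of the closed
one, makes it sufficient that cutoff functions equal 1 on \<open>[-R, R]\<close> itself.\<close>
definition supported_in :: "functional \<Rightarrow> real \<Rightarrow> bool" where
  "supported_in u R \<longleftrightarrow> (\<forall>g. test_fun g \<longrightarrow> (\<forall>x. \<bar>x\<bar> < R \<longrightarrow> g x = 0) \<longrightarrow> u g = 0)"

lemma compactly_supported_supported_in:
  assumes "compactly_supported u" obtains R where "0 < R" "supported_in u R"
proof -
  obtain K where K: "compact K" "\<forall>f. test_fun f \<and> supp f \<inter> K = {} \<longrightarrow> u f = 0"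
    using assms unfolding compactly_supported_def by blast
  obtain R where R: "R > 0" "K \<subseteq> {-R..R}"
    using compact_real_bounded[OF K(1)] by blast
  have "supported_in u (R + 1)"
    unfolding supported_in_def
  proof (intro allI impI)
    fix g assume g: "test_fun g" "\<forall>x. \<bar>x\<bar> < R + 1 \<longrightarrow> g x = 0"
    have "supp g \<subseteq> - {-R-1<..<R+1}"
      using g(2) by (intro supp_subset) (auto simp: abs_less_iff)
    then have "supp g \<inter> K = {}" using R by force
    then show "u g = 0" using K g by blast
  qed
  then show ?thesis using that[of "R + 1"] R by simp
qed

lemma supported_in_cong:
  assumes "distribution u" "supported_in u R" "test_fun f" "test_fun g"
    "\<And>x. \<bar>x\<bar> < R \<Longrightarrow> f x = g x"
  shows "u f = u g"
proof -
  have "u (\<lambda>x. f x - g x) = 0"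
    using assms(2,5) test_fun_diff[OF assms(3,4)] unfolding supported_in_def by simp
  then show ?thesis using distribution_minus[OF assms(1,3,4)] by simp
qed

text \<open>Two cutoff functions differ by a function that vanishes on \<open>(-R, R)\<close>, so the value does not depend on
the choice, and the description of \<open>pairing\<close> is met by exactly one number. Any compact set that
occurs there can be enlarged together with \<open>[-R, R]\<close>, because cutoff functions exist for all intervals.\<close>
lemma pairing_eq:
  assumes u: "distribution u" "supported_in u R" and g: "smooth g"
    and \<eta>: "test_fun \<eta>" "\<And>x. \<bar>x\<bar> \<le> R \<Longrightarrow> \<eta> x = 1"
  shows "pairing u g = u (\<lambda>x. \<eta> x * g x)"
  unfolding pairing_def
proof (rule the_equality)
  show "\<exists>K. compact K \<and> (\<forall>\<eta>'. test_fun \<eta>' \<and> (\<forall>x\<in>K. \<eta>' x = 1) \<longrightarrow>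
      u (\<lambda>x. \<eta>' x * g x) = u (\<lambda>x. \<eta> x * g x))"
  proof (intro exI[of _ "{-R..R}"] conjI allI impI)
    fix \<eta>' assume \<eta>': "test_fun \<eta>' \<and> (\<forall>x\<in>{-R..R}. \<eta>' x = 1)"
    then show "u (\<lambda>x. \<eta>' x * g x) = u (\<lambda>x. \<eta> x * g x)"
      by (intro supported_in_cong[OF u] test_fun_mult \<eta>(1) g) (auto simp: \<eta>(2) abs_less_iff)
  qed simp
next
  fix z assume "\<exists>K. compact K \<and> (\<forall>\<eta>. test_fun \<eta> \<and> (\<forall>x\<in>K. \<eta> x = 1) \<longrightarrow> u (\<lambda>x. \<eta> x * g x) = z)"
  then obtain K where K: "compact K" "\<forall>\<eta>. test_fun \<eta> \<and> (\<forall>x\<in>K. \<eta> x = 1) \<longrightarrow> u (\<lambda>x. \<eta> x * g x) = z"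
    by blast
  obtain S where S: "K \<subseteq> {-S..S}"
    using compact_real_bounded[OF K(1)] by blast
  obtain \<eta>' where \<eta>': "test_fun \<eta>'" "\<forall>x. \<bar>x\<bar> \<le> max R S \<longrightarrow> \<eta>' x = 1"
    using cutoff_exists by blast
  have "\<forall>x\<in>K. \<eta>' x = 1"
    using S \<eta>'(2) by (auto simp: subset_iff abs_le_iff le_max_iff_disj)
  then have "z = u (\<lambda>x. \<eta>' x * g x)"
    using K(2) \<eta>'(1) by blast
  also have "\<dots> = u (\<lambda>x. \<eta> x * g x)"
    using \<eta>' by (intro supported_in_cong[OF u] test_fun_mult \<eta>(1) g) (auto simp: \<eta>(2))
  finally show "z = u (\<lambda>x. \<eta> x * g x)" .
qed

lemma smooth_fourier_kernel: "smooth (\<lambda>x. exp (- (2 * of_real pi * \<i> * of_real x * of_real y)))"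
  using smooth_exp[of "- (2 * of_real pi * \<i> * of_real y)"] by (simp add: mult_ac)

lemma fourier_eq:
  assumes "distribution u" "supported_in u R" "test_fun \<eta>" "\<And>x. \<bar>x\<bar> \<le> R \<Longrightarrow> \<eta> x = 1"
  shows "fourier u y = u (\<lambda>x. \<eta> x * exp (- (2 * of_real pi * \<i> * of_real x * of_real y)))"
  unfolding fourier_def by (rule pairing_eq[OF assms(1,2) smooth_fourier_kernel assms(3,4)])

section \<open>Density of exponential sums and injectivity of the Fourier transform\<close>

text \<open>All real frequencies are admitted. Hence these functions separate the points of every
interval, and no periodicity has to be arranged.\<close>
inductive exp_sum :: "(real \<Rightarrow> complex) \<Rightarrow> bool" where
  exp_sum_exp: "exp_sum (\<lambda>x. c * exp (\<i> * of_real \<theta> * of_real x))"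
| exp_sum_add: "exp_sum S \<Longrightarrow> exp_sum T \<Longrightarrow> exp_sum (\<lambda>x. S x + T x)"

lemma smooth_exp_sum: "exp_sum T \<Longrightarrow> smooth T"
  by (induction rule: exp_sum.induct) (auto intro: smooth_cmult[OF smooth_exp] smooth_add)

lemma exp_sum_const: "exp_sum (\<lambda>x. c)"
  using exp_sum_exp[of c 0] by simp

lemma exp_sum_mult:
  assumes "exp_sum S" "exp_sum T" shows "exp_sum (\<lambda>x. S x * T x)"
  using assms(1)
proof (induction rule: exp_sum.induct)
  case (exp_sum_exp c \<theta>)
  show ?case using assms(2)
  proof (induction rule: exp_sum.induct)
    case (exp_sum_exp c' \<theta>')
    have "(\<lambda>x. c * exp (\<i> * of_real \<theta> * of_real x) * (c' * exp (\<i> * of_real \<theta>' * of_real x)))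
        = (\<lambda>x. (c * c') * exp (\<i> * of_real (\<theta> + \<theta>') * of_real x))"
      by (simp add: fun_eq_iff algebra_simps exp_add)
    then show ?case by (simp only: exp_sum.exp_sum_exp)
  qed (auto simp: distrib_left intro: exp_sum.exp_sum_add)
qed (auto simp: distrib_right intro: exp_sum.exp_sum_add)

text \<open>The Stone-Weierstrass theorem. The points \<open>x\<close> and \<open>y\<close> are separated by \<open>sin (\<theta> (t - y))\<close> with
\<open>\<theta> (x - y) = \<pi> / 2\<close>.\<close>
lemma exp_sum_dense_real:
  fixes f :: "real \<Rightarrow> real"
  assumes "continuous_on {-R..R} f" "0 < e"
  obtains g where "exp_sum (\<lambda>x. of_real (g x))" "\<forall>x\<in>{-R..R}. \<bar>f x - g x\<bar> < e"
proof -
  interpret function_ring_on "{g. exp_sum (\<lambda>x. complex_of_real (g x))}" "{-R..R}"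
  proof
    fix g assume "g \<in> {g. exp_sum (\<lambda>x. complex_of_real (g x))}"
    then have "continuous_on {-R..R} (\<lambda>x. Re (of_real (g x)))"
      using smooth_imp_continuous_on[OF smooth_exp_sum, of "\<lambda>x. of_real (g x)" _ 0]
      by (intro continuous_on_Re) simp
    then show "continuous_on {-R..R} g" by simp
  next
    fix x y :: real assume "x \<noteq> y"
    define \<theta> where "\<theta> = pi / (2 * (x - y))"
    have \<theta>: "\<theta> * (x - y) = pi / 2" using \<open>x \<noteq> y\<close> by (simp add: \<theta>_def divide_simps)
    define g where "g t = sin (\<theta> * (t - y))" for t
    have "complex_of_real (g t) =
       (exp (- \<i> * of_real (\<theta> * y)) / (2 * \<i>)) * exp (\<i> * of_real \<theta> * of_real t) +
       (- exp (\<i> * of_real (\<theta> * y)) / (2 * \<i>)) * exp (\<i> * of_real (- \<theta>) * of_real t)" for t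
    proof -
      have "complex_of_real (g t) =
          (exp (\<i> * of_real (\<theta> * (t - y))) - exp (- (\<i> * of_real (\<theta> * (t - y))))) / (2 * \<i>)"
        unfolding g_def sin_of_real[symmetric] sin_exp_eq ..
      also have "exp (\<i> * of_real (\<theta> * (t - y))) =
          exp (- \<i> * of_real (\<theta> * y)) * exp (\<i> * of_real \<theta> * of_real t)"
        unfolding exp_add[symmetric] by (simp add: algebra_simps)
      also have "exp (- (\<i> * of_real (\<theta> * (t - y)))) =
          exp (\<i> * of_real (\<theta> * y)) * exp (\<i> * of_real (- \<theta>) * of_real t)"
        unfolding exp_add[symmetric] by (simp add: algebra_simps)
      finally show ?thesis by (simp add: algebra_simps diff_divide_distrib)
    qed
    then have "exp_sum (\<lambda>t. complex_of_real (g t))"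
      by (simp only: exp_sum.exp_sum_add exp_sum.exp_sum_exp)
    moreover have "g x \<noteq> g y" by (simp add: g_def \<theta>)
    ultimately show "\<exists>f\<in>{g. exp_sum (\<lambda>x. complex_of_real (g x))}. f x \<noteq> f y" by blast
  next
    fix g h assume "g \<in> {g. exp_sum (\<lambda>x. complex_of_real (g x))}" "h \<in> {g. exp_sum (\<lambda>x. complex_of_real (g x))}"
    then show "(\<lambda>x. g x + h x) \<in> {g. exp_sum (\<lambda>x. complex_of_real (g x))}"
      and "(\<lambda>x. g x * h x) \<in> {g. exp_sum (\<lambda>x. complex_of_real (g x))}"
      using exp_sum_add[of "\<lambda>x. of_real (g x)" "\<lambda>x. of_real (h x)"]
        exp_sum_mult[of "\<lambda>x. of_real (g x)" "\<lambda>x. of_real (h x)"] by simp_all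
  qed (simp_all add: exp_sum_const)
  show ?thesis
    using Stone_Weierstrass_basic[OF assms] that by blast
qed

lemma exp_sum_dense:
  assumes "continuous_on {-R..R} f" "0 < e"
  obtains T where "exp_sum T" "\<forall>x. \<bar>x\<bar> \<le> R \<longrightarrow> norm (f x - T x) \<le> e"
proof -
  obtain g where g: "exp_sum (\<lambda>x. of_real (g x))" "\<forall>x\<in>{-R..R}. \<bar>Re (f x) - g x\<bar> < e / 2"
    using exp_sum_dense_real[of R "\<lambda>x. Re (f x)" "e / 2"] assms by (auto intro: continuous_on_Re)
  obtain h where h: "exp_sum (\<lambda>x. of_real (h x))" "\<forall>x\<in>{-R..R}. \<bar>Im (f x) - h x\<bar> < e / 2"
    using exp_sum_dense_real[of R "\<lambda>x. Im (f x)" "e / 2"] assms by (auto intro: continuous_on_Im)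
  have "exp_sum (\<lambda>x. of_real (g x) + \<i> * of_real (h x))"
    by (intro exp_sum_add exp_sum_mult exp_sum_const g h)
  moreover have "norm (f x - (of_real (g x) + \<i> * of_real (h x))) \<le> e" if "\<bar>x\<bar> \<le> R" for x
  proof -
    have "x \<in> {-R..R}" using that by (auto simp: abs_le_iff)
    then have "\<bar>Re (f x) - g x\<bar> < e / 2" "\<bar>Im (f x) - h x\<bar> < e / 2" using g h by auto
    then show ?thesis
      using cmod_le[of "f x - (of_real (g x) + \<i> * of_real (h x))"] by simp
  qed
  ultimately show ?thesis using that by blast
qed

lemma higher_deriv_cmult_exp:
  "higher_deriv k (\<lambda>x. c * exp (d * of_real x)) = (\<lambda>x. c * (d ^ k * exp (d * of_real x)))"
  by (simp add: higher_deriv_cmult[OF smooth_exp] higher_deriv_exp)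

text \<open>An exponential sum has a primitive of the same kind except for its constant term, whose primitive is
linear. The constant is therefore first replaced by \<open>c e^(\<i> \<tau> x)\<close> with a small frequency \<open>\<tau>\<close>, which is close
to it on bounded sets together with all derivatives.\<close>
lemma exp_sum_approx_primitive:
  assumes "exp_sum T" "0 < e"
  shows "\<exists>S. exp_sum S \<and> (\<forall>j x. \<bar>x\<bar> \<le> R \<longrightarrow> norm (higher_deriv (Suc j) S x - higher_deriv j T x) \<le> e)"
  using assms
proof (induction arbitrary: e rule: exp_sum.induct)
  case (exp_sum_exp c \<theta>)
  show ?case
  proof (cases "\<theta> = 0")
    case False
    have "higher_deriv (Suc j) (\<lambda>x. c / (\<i> * of_real \<theta>) * exp (\<i> * of_real \<theta> * of_real x)) x =
        higher_deriv j (\<lambda>x. c * exp (\<i> * of_real \<theta> * of_real x)) x" for j x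
      unfolding higher_deriv_cmult_exp using False by simp
    then show ?thesis
      using exp_sum.exp_sum_exp[of "c / (\<i> * of_real \<theta>)" \<theta>] exp_sum_exp by (metis cancel_comm_monoid_add_class.diff_cancel norm_zero less_imp_le)
  next
    case True
    define \<tau> where "\<tau> = min 1 (e / ((norm c + 1) * (\<bar>R\<bar> + 1)))"
    have pos: "0 < (norm c + 1) * (\<bar>R\<bar> + 1)"
      by (intro mult_pos_pos) (auto intro: add_nonneg_pos)
    then have \<tau>: "0 < \<tau>" "\<tau> \<le> 1" using exp_sum_exp by (auto simp: \<tau>_def)
    have "\<tau> \<le> e / ((norm c + 1) * (\<bar>R\<bar> + 1))" by (simp add: \<tau>_def)
    then have e: "norm c * (\<tau> * (\<bar>R\<bar> + 1)) \<le> e"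
      using pos \<tau>(1) by (simp add: field_simps) (smt (verit) mult_nonneg_nonneg abs_ge_zero)
    have "norm (higher_deriv (Suc j) (\<lambda>x. c / (\<i> * of_real \<tau>) * exp (\<i> * of_real \<tau> * of_real x)) x -
        higher_deriv j (\<lambda>x. c * exp (\<i> * of_real \<theta> * of_real x)) x) \<le> e" if "\<bar>x\<bar> \<le> R" for j x
    proof -
      let ?E = "exp (\<i> * of_real (\<tau> * x))"
      have "norm ((\<i> * of_real \<tau>) ^ j * ?E - 0 ^ j) \<le> \<tau> * (\<bar>R\<bar> + 1)"
      proof (cases j)
        case 0
        have "norm (?E - 1) = 2 * \<bar>sin (\<tau> * x / 2)\<bar>" by (rule dist_exp_i_1)
        also have "\<dots> \<le> 2 * \<bar>\<tau> * x / 2\<bar>" by (intro mult_left_mono abs_sin_x_le_abs_x) auto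
        also have "\<dots> \<le> \<tau> * (\<bar>R\<bar> + 1)" using that \<tau> by (simp add: abs_mult)
        finally show ?thesis using 0 by simp
      next
        case (Suc i)
        have "norm ((\<i> * of_real \<tau>) ^ j * ?E) = \<tau> * \<tau> ^ i"
          using \<tau> Suc by (simp add: norm_mult norm_power)
        also have "\<dots> \<le> \<tau> * (\<bar>R\<bar> + 1)"
          using \<tau> power_le_one[of \<tau> i] by (intro mult_left_mono) auto
        finally show ?thesis using Suc by simp
      qed
      then have "norm (c * ((\<i> * of_real \<tau>) ^ j * ?E - 0 ^ j)) \<le> norm c * (\<tau> * (\<bar>R\<bar> + 1))"
        unfolding norm_mult by (intro mult_left_mono) auto
      moreover have "higher_deriv (Suc j) (\<lambda>x. c / (\<i> * of_real \<tau>) * exp (\<i> * of_real \<tau> * of_real x)) x -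
        higher_deriv j (\<lambda>x. c * exp (\<i> * of_real \<theta> * of_real x)) x =
          c * ((\<i> * of_real \<tau>) ^ j * ?E - 0 ^ j)"
        unfolding higher_deriv_cmult_exp using \<tau> True by (simp add: right_diff_distrib mult.assoc)
      ultimately show ?thesis using e by simp
    qed
    then show ?thesis using exp_sum.exp_sum_exp by blast
  qed
next
  case (exp_sum_add T1 T2)
  obtain S1 where S1: "exp_sum S1"
    "\<forall>j x. \<bar>x\<bar> \<le> R \<longrightarrow> norm (higher_deriv (Suc j) S1 x - higher_deriv j T1 x) \<le> e / 2"
    using exp_sum_add.IH(1)[of "e / 2"] exp_sum_add.prems by auto
  obtain S2 where S2: "exp_sum S2"
    "\<forall>j x. \<bar>x\<bar> \<le> R \<longrightarrow> norm (higher_deriv (Suc j) S2 x - higher_deriv j T2 x) \<le> e / 2"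
    using exp_sum_add.IH(2)[of "e / 2"] exp_sum_add.prems by auto
  have "norm (higher_deriv (Suc j) (\<lambda>x. S1 x + S2 x) x - higher_deriv j (\<lambda>x. T1 x + T2 x) x) \<le> e"
    if "\<bar>x\<bar> \<le> R" for j x
    unfolding higher_deriv_add[OF smooth_exp_sum[OF S1(1)] smooth_exp_sum[OF S2(1)]]
      higher_deriv_add[OF smooth_exp_sum[OF exp_sum_add.hyps(1)] smooth_exp_sum[OF exp_sum_add.hyps(2)]]
    using norm_triangle_ineq[of "higher_deriv (Suc j) S1 x - higher_deriv j T1 x"
        "higher_deriv (Suc j) S2 x - higher_deriv j T2 x"]
      S1(2)[rule_format, OF that, of j] S2(2)[rule_format, OF that, of j]
    by (simp add: algebra_simps)
  then show ?case using exp_sum.exp_sum_add[OF S1(1) S2(1)] by blast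
qed

text \<open>Approximation with \<open>m + 1\<close> derivatives is reduced to approximation of the derivative with \<open>m\<close>
derivatives: approximate \<open>f'\<close>, pass to an approximate primitive, and adjust the constant so that both
functions agree at 0. The mean value theorem controls the remaining difference.\<close>
lemma exp_sum_dense_smooth:
  assumes "smooth f" "0 < e"
  shows "\<exists>T. exp_sum T \<and> (\<forall>j\<le>m. \<forall>x. \<bar>x\<bar> \<le> R \<longrightarrow> norm (higher_deriv j f x - higher_deriv j T x) \<le> e)"
  using assms
proof (induction m arbitrary: f e)
  case 0
  obtain T where "exp_sum T" "\<forall>x. \<bar>x\<bar> \<le> R \<longrightarrow> norm (f x - T x) \<le> e"
    using exp_sum_dense[OF smooth_imp_continuous_on[OF 0(1), of _ 0, unfolded higher_deriv_0] 0(2)] by blast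
  then show ?case by auto
next
  case (Suc m)
  define \<delta> where "\<delta> = e / (2 * (\<bar>R\<bar> + 1))"
  have \<delta>: "0 < \<delta>" "2 * \<delta> \<le> e" "2 * \<delta> * \<bar>R\<bar> \<le> e"
    using Suc.prems(2) by (auto simp: \<delta>_def field_simps)
  note f' = smooth_derivative[OF Suc.prems(1)]
  obtain T where T: "exp_sum T"
    "\<forall>j\<le>m. \<forall>x. \<bar>x\<bar> \<le> R \<longrightarrow> norm (higher_deriv (Suc j) f x - higher_deriv j T x) \<le> \<delta>"
    using Suc.IH[OF f'(2) \<delta>(1)] unfolding f'(3) by blast
  obtain S where S: "exp_sum S"
    "\<forall>j x. \<bar>x\<bar> \<le> R \<longrightarrow> norm (higher_deriv (Suc j) S x - higher_deriv j T x) \<le> \<delta>"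
    using exp_sum_approx_primitive[OF T(1) \<delta>(1)] by blast
  have D: "norm (higher_deriv (Suc j) f x - higher_deriv (Suc j) S x) \<le> 2 * \<delta>" if "j \<le> m" "\<bar>x\<bar> \<le> R" for j x
    using norm_triangle_ineq4[of "higher_deriv (Suc j) f x - higher_deriv j T x"
        "higher_deriv (Suc j) S x - higher_deriv j T x"] T(2) S(2) that
    by (smt (verit) diff_diff_eq2 diff_add_cancel add_diff_cancel)
  define U where "U x = S x + (f 0 - S 0)" for x
  have U: "exp_sum U"
    unfolding U_def by (intro exp_sum_add S exp_sum_const)
  have U': "higher_deriv (Suc j) U = higher_deriv (Suc j) S" for j
    unfolding U_def higher_deriv_add[OF smooth_exp_sum[OF S(1)] smooth_const] by (simp add: higher_deriv_const)
  have "norm (f x - U x) \<le> e" if x: "\<bar>x\<bar> \<le> R" for x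
  proof -
    have "norm ((f x - U x) - (f 0 - U 0)) \<le> 2 * \<delta> * norm (x - 0)"
    proof (rule differentiable_bound[of "{-R..R}" _ "\<lambda>t h. h *\<^sub>R (higher_deriv 1 f t - higher_deriv 1 U t)"])
      fix t assume t: "t \<in> {-R..R}"
      have "((\<lambda>x. f x - U x) has_vector_derivative higher_deriv 1 f t - higher_deriv 1 U t) (at t)"
        by (intro has_vector_derivative_diff f'(1) smooth_derivative(1) smooth_exp_sum U)
      then show "((\<lambda>x. f x - U x) has_derivative (\<lambda>h. h *\<^sub>R (higher_deriv 1 f t - higher_deriv 1 U t)))
          (at t within {-R..R})"
        unfolding has_vector_derivative_def by (rule has_derivative_at_withinI)
      show "onorm (\<lambda>h. h *\<^sub>R (higher_deriv 1 f t - higher_deriv 1 U t)) \<le> 2 * \<delta>"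
      proof (rule onorm_bound)
        fix h :: real
        have "norm (higher_deriv 1 f t - higher_deriv 1 U t) \<le> 2 * \<delta>"
          using D[of 0 t] t U'[of 0] by (auto simp: abs_le_iff)
        then show "norm (h *\<^sub>R (higher_deriv 1 f t - higher_deriv 1 U t)) \<le> 2 * \<delta> * norm h"
          by (simp add: mult.commute[of "2 * \<delta>"] mult_left_mono)
      qed (use \<delta> in auto)
    qed (use x in auto)
    also have "2 * \<delta> * norm (x - 0) \<le> 2 * \<delta> * \<bar>R\<bar>"
      using x \<delta>(1) by (intro mult_left_mono) auto
    finally show ?thesis using \<delta>(3) by (simp add: U_def)
  qed
  moreover have "norm (higher_deriv (Suc j) f x - higher_deriv (Suc j) U x) \<le> e" if "j \<le> m" "\<bar>x\<bar> \<le> R" for j x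
    using D[OF that] \<delta>(2) unfolding U' by simp
  ultimately have "norm (higher_deriv j f x - higher_deriv j U x) \<le> e" if "j \<le> Suc m" "\<bar>x\<bar> \<le> R" for j x
    using that by (cases j) auto
  then show ?case using U by blast
qed

text \<open>A vanishing transform means that \<open>u\<close> annihilates all exponential sums. On bounded sets these
are dense with respect to the seminorms that bound \<open>u\<close>, so \<open>u\<close> annihilates every test function.\<close>
lemma fourier_injective:
  assumes u: "distribution u" "supported_in u R" and zero: "\<And>y. fourier u y = 0" and f: "test_fun f"
  shows "u f = 0"
proof -
  obtain \<eta> where \<eta>: "test_fun \<eta>" "\<forall>x. \<bar>x\<bar> \<le> R \<longrightarrow> \<eta> x = 1"
    using cutoff_exists by blast
  obtain R' where R': "R' > 0" "supp \<eta> \<subseteq> {-R'..R'}" "\<forall>x. R' < \<bar>x\<bar> \<longrightarrow> \<eta> x = 0"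
    by (rule test_funE[OF \<eta>(1)])
  obtain B m where B: "0 \<le> B" "\<forall>f M. test_fun f \<longrightarrow> (\<forall>x. R' < \<bar>x\<bar> \<longrightarrow> f x = 0) \<longrightarrow>
       (\<forall>k\<le>m. \<forall>x. norm (higher_deriv k f x) \<le> M) \<longrightarrow> norm (u f) \<le> B * M"
    using distribution_bound[OF u(1)] by blast
  have "\<forall>k. \<exists>A. \<forall>x. norm (higher_deriv k \<eta> x) \<le> A"
    using test_fun_deriv_bounded[OF \<eta>(1)] by metis
  then obtain A' where A': "\<And>k x. norm (higher_deriv k \<eta> x) \<le> A' k" by metis
  have A'0: "0 \<le> A' k" for k using A'[of k 0] norm_ge_zero order_trans by blast
  define A where "A = (\<Sum>k\<le>m. A' k)"
  have A: "norm (higher_deriv k \<eta> x) \<le> A" if "k \<le> m" for k x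
    using A'[of k x] member_le_sum[of k "{..m}" A'] A'0 that by (auto simp: A_def)
  have null: "u (\<lambda>x. \<eta> x * T x) = 0" if "exp_sum T" for T
    using that
  proof (induction rule: exp_sum.induct)
    case (exp_sum_exp c \<theta>)
    have "fourier u (- \<theta> / (2 * pi)) = u (\<lambda>x. \<eta> x * exp (\<i> * of_real \<theta> * of_real x))"
      using fourier_eq[OF u \<eta>(1), of "- \<theta> / (2 * pi)"] \<eta>(2) by (simp add: mult_ac)
    then have "u (\<lambda>x. c * (\<eta> x * exp (\<i> * of_real \<theta> * of_real x))) = 0"
      using distribution_times[OF u(1) test_fun_mult[OF \<eta>(1) smooth_exp]] zero by simp
    then show ?case by (simp add: mult_ac)
  next
    case (exp_sum_add S T)
    then show ?case
      using distribution_plus[OF u(1) test_fun_mult[OF \<eta>(1)] test_fun_mult[OF \<eta>(1)], of S T]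
      by (simp add: distrib_left smooth_exp_sum)
  qed
  have est: "norm (u f) \<le> B * (2 ^ m * (A * e))" if e: "e > 0" for e
  proof -
    obtain T where T: "exp_sum T"
      "\<forall>j\<le>m. \<forall>x. \<bar>x\<bar> \<le> R' \<longrightarrow> norm (higher_deriv j f x - higher_deriv j T x) \<le> e"
      using exp_sum_dense_smooth[OF test_fun_smooth[OF f] e] by blast
    note T' = smooth_exp_sum[OF T(1)]
    define h where "h x = f x - T x" for x
    have h: "smooth h" "\<And>k x. higher_deriv k h x = higher_deriv k f x - higher_deriv k T x"
      unfolding h_def
      by (rule smooth_diff[OF test_fun_smooth[OF f] T']) (simp add: higher_deriv_diff[OF test_fun_smooth[OF f] T'])
    have "0 \<le> A * e" using e A'0 by (auto simp: A_def sum_nonneg)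
    have "norm (higher_deriv k (\<lambda>x. \<eta> x * h x) x) \<le> 2 ^ m * (A * e)" if "k \<le> m" for k x
    proof (cases "\<bar>x\<bar> \<le> R'")
      case True
      have "norm (higher_deriv k (\<lambda>x. \<eta> x * h x) x) \<le> 2 ^ k * (A * e)"
        using A T(2) that True
        by (intro higher_deriv_mult_bound test_fun_smooth[OF \<eta>(1)] h(1)) (auto simp: h(2))
      also have "\<dots> \<le> 2 ^ m * (A * e)"
        using that \<open>0 \<le> A * e\<close> by (intro mult_right_mono power_increasing) auto
      finally show ?thesis .
    next
      case False
      then have "x \<notin> supp (\<lambda>x. \<eta> x * h x)"
        using supp_subset[of "{-R'..R'}" "\<lambda>x. \<eta> x * h x"] R'(3) by (force simp: abs_le_iff)
      then show ?thesis
        using \<open>0 \<le> A * e\<close> by (simp add: higher_deriv_outside_supp)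
    qed
    then have "norm (u (\<lambda>x. \<eta> x * h x)) \<le> B * (2 ^ m * (A * e))"
      using B(2) test_fun_mult[OF \<eta>(1) h(1)] R'(3) by simp
    moreover have "u f = u (\<lambda>x. \<eta> x * h x)"
    proof -
      have "u f = u (\<lambda>x. \<eta> x * h x + \<eta> x * T x)"
      proof (rule supported_in_cong[OF u f])
        show "test_fun (\<lambda>x. \<eta> x * h x + \<eta> x * T x)"
          by (intro test_fun_add test_fun_mult \<eta>(1) h(1) T')
        show "f x = \<eta> x * h x + \<eta> x * T x" if "\<bar>x\<bar> < R" for x
          using \<eta>(2) that by (simp add: h_def)
      qed
      also have "\<dots> = u (\<lambda>x. \<eta> x * h x)"
        using distribution_plus[OF u(1) test_fun_mult[OF \<eta>(1) h(1)] test_fun_mult[OF \<eta>(1) T']]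
          null[OF T(1)] by simp
      finally show ?thesis .
    qed
    ultimately show ?thesis by simp
  qed
  have "norm (u f) \<le> 0 + e" if "e > 0" for e
  proof -
    define K where "K = B * 2 ^ m * A"
    have "0 \<le> K" using B(1) A'0 by (auto simp: K_def A_def sum_nonneg)
    have "norm (u f) \<le> K * (e / (K + 1))"
      using est[of "e / (K + 1)"] \<open>0 \<le> K\<close> that by (simp add: K_def mult.assoc)
    also have "\<dots> \<le> e" using \<open>0 \<le> K\<close> that by (simp add: field_simps)
    finally show ?thesis by simp
  qed
  then show ?thesis using field_le_epsilon[of "norm (u f)" 0] by simp
qed

section \<open>The two-scale relation\<close>

text \<open>The case \<open>f 0 = 0\<close> is separate: an infinite product has the value 0 precisely if one of
its factors is 0.\<close>
lemma has_prod_split_first: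
  fixes f :: "nat \<Rightarrow> complex"
  assumes "(\<lambda>n. f (Suc n)) has_prod p" "f has_prod q"
  shows "q = f 0 * p"
proof (cases "f 0 = 0")
  case True
  then show ?thesis using has_prod_eq_0_iff[OF assms(2)] by (metis mult_zero_left rangeI)
next
  case False
  then have "f has_prod (p * f 0)" using has_prod_Suc_iff[of f p] False assms(1) by blast
  then show ?thesis using assms(2) has_prod_unique2 by (metis mult.commute)
qed

text \<open>The difference \<open>v\<close> of both sides is a compactly supported distribution in \<open>g\<close> with transform
\<open>\<phi>^(2 y) - a(y) \<phi>^(y)\<close>. This is 0 because the infinite product for \<open>\<phi>^(2 y)\<close> is the one for \<open>\<phi>^(y)\<close> with
the additional first factor \<open>a(y)\<close>.\<close>
lemma refinement_equation:
  assumes \<phi>: "distribution \<phi>" "compactly_supported \<phi>"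
    and a: "\<And>y. a y = (\<Sum>m\<le>N. of_real (c m) * exp (- (2 * of_real pi * \<i> * of_nat m * of_real y)))"
    and prod: "\<And>y. (\<lambda>j. a (y / 2 ^ Suc j)) has_prod fourier \<phi> y"
    and g: "test_fun g"
  shows "\<phi> (\<lambda>x. g (2 * x)) = (\<Sum>m\<le>N. of_real (c m) * \<phi> (\<lambda>x. g (x + real m)))"
proof -
  obtain R where R: "0 < R" "supported_in \<phi> R"
    using compactly_supported_supported_in[OF \<phi>(2)] by blast
  \<comment> \<open>\<open>2 R\<close> accounts for the dilation and \<open>N\<close> for the largest shift\<close>
  define S where "S = 2 * R + real N"
  define v where "v g = \<phi> (\<lambda>x. g (2 * x)) + (\<Sum>m\<le>N. - of_real (c m) * \<phi> (\<lambda>x. g (x + real m)))" for g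
  have v: "distribution v"
    unfolding v_def
    using distribution_affine[OF \<phi>(1), of 2 0] distribution_affine[OF \<phi>(1), of 1]
    by (intro distribution_add distribution_sum distribution_cmult) simp_all
  have v_supp: "supported_in v S"
    unfolding supported_in_def
  proof (intro allI impI)
    fix g assume g: "test_fun g" "\<forall>x. \<bar>x\<bar> < S \<longrightarrow> g x = 0"
    have "\<phi> (\<lambda>x. g (2 * x)) = 0"
      using R(2) test_fun_affine[OF g(1), of 2 0] g(2) by (auto simp: supported_in_def S_def)
    moreover have "\<phi> (\<lambda>x. g (x + real m)) = 0" if "m \<le> N" for m
    proof -
      have "g (x + real m) = 0" if "\<bar>x\<bar> < R" for x
        using that \<open>m \<le> N\<close> R(1) by (intro g(2)[rule_format]) (auto simp: S_def)
      then show ?thesis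
        using R(2) test_fun_affine[OF g(1), of 1 "real m"] by (auto simp: supported_in_def)
    qed
    ultimately show "v g = 0" by (simp add: v_def)
  qed
  obtain \<eta> where \<eta>: "test_fun \<eta>" "\<forall>x. \<bar>x\<bar> \<le> S \<longrightarrow> \<eta> x = 1"
    using cutoff_exists by blast
  have "fourier v y = 0" for y
  proof -
    define E where "E y x = exp (- (2 * of_real pi * \<i> * of_real x * of_real y))" for x y :: real
    have E: "smooth (E y)" for y
      unfolding E_def by (rule smooth_fourier_kernel)
    have E_add: "E y (s + t) = E y s * E y t" for s t
      by (simp add: E_def algebra_simps flip: exp_add)
    have 1: "\<phi> (\<lambda>x. \<eta> (2 * x) * E y (2 * x)) = fourier \<phi> (2 * y)"
    proof -
      have "fourier \<phi> (2 * y) = \<phi> (\<lambda>x. \<eta> (2 * x + 0) * E (2 * y) x)"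
        unfolding E_def
        by (rule fourier_eq[OF \<phi>(1) R(2) test_fun_affine[OF \<eta>(1)]]) (use \<eta>(2) in \<open>auto simp: S_def\<close>)
      then show ?thesis by (simp add: E_def mult_ac)
    qed
    have 2: "\<phi> (\<lambda>x. \<eta> (x + real m) * E y (x + real m)) = E y (real m) * fourier \<phi> y" if "m \<le> N" for m
    proof -
      have \<eta>m: "test_fun (\<lambda>x. \<eta> (x + real m))"
        using test_fun_affine[OF \<eta>(1), of 1 "real m"] by simp
      have "fourier \<phi> y = \<phi> (\<lambda>x. \<eta> (x + real m) * E y x)"
        unfolding E_def using that R(1)
        by (intro fourier_eq[OF \<phi>(1) R(2) \<eta>m] \<eta>(2)[rule_format]) (auto simp: S_def)
      then have "E y (real m) * fourier \<phi> y = \<phi> (\<lambda>x. E y (real m) * (\<eta> (x + real m) * E y x))"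
        using distribution_times[OF \<phi>(1) test_fun_mult[OF \<eta>m E]] by simp
      also have "(\<lambda>x. E y (real m) * (\<eta> (x + real m) * E y x)) = (\<lambda>x. \<eta> (x + real m) * E y (x + real m))"
        by (simp add: E_add mult_ac)
      finally show ?thesis ..
    qed
    have "fourier v y = v (\<lambda>x. \<eta> x * E y x)"
      unfolding E_def by (rule fourier_eq[OF v v_supp \<eta>(1)]) (use \<eta>(2) in auto)
    also have "\<dots> = fourier \<phi> (2 * y) - (\<Sum>m\<le>N. of_real (c m) * (E y (real m) * fourier \<phi> y))"
      unfolding v_def 1 using 2 by (simp add: sum_negf)
    also have "(\<Sum>m\<le>N. of_real (c m) * (E y (real m) * fourier \<phi> y)) = a y * fourier \<phi> y"
      unfolding a sum_distrib_right E_def by (simp add: mult_ac)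
    also have "fourier \<phi> (2 * y) = a y * fourier \<phi> y"
      using has_prod_split_first[of "\<lambda>j. a (2 * y / 2 ^ Suc j)", OF _ prod[of "2 * y"]] prod[of y] by simp
    finally show ?thesis by simp
  qed
  then have "v g = 0" using fourier_injective[OF v v_supp _ g] by blast
  then show ?thesis by (simp add: v_def sum_negf)
qed

section \<open>Dilation invariance and linear dependence of dilates\<close>

lemma shift_sum_eq:
  assumes "supported_in \<phi> R" "test_fun f" "\<And>x. S < \<bar>x\<bar> \<Longrightarrow> f x = 0" "R + S \<le> of_int M"
  shows "shift_sum \<phi> c f = (\<Sum>l\<in>{-M..M}. c l * \<phi> (\<lambda>x. f (x + of_int l)))"
    and "\<And>l. M < \<bar>l\<bar> \<Longrightarrow> \<phi> (\<lambda>x. f (x + of_int l)) = 0"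
proof -
  show zero: "\<phi> (\<lambda>x. f (x + of_int l)) = 0" if "M < \<bar>l\<bar>" for l
  proof -
    have "real_of_int M < \<bar>of_int l\<bar>" using that by linarith
    then have "f (x + of_int l) = 0" if "\<bar>x\<bar> < R" for x
      using that assms(4) by (intro assms(3)) linarith
    then show ?thesis
      using assms(1) test_fun_affine[OF assms(2), of 1 "of_int l"] by (simp add: supported_in_def)
  qed
  have "{l. shift l \<phi> f \<noteq> 0} \<subseteq> {-M..M}"
    using zero by (force simp: shift_def not_less[symmetric])
  then have "shift_sum \<phi> c f = (\<Sum>l\<in>{-M..M}. c l * shift l \<phi> f)"
    unfolding shift_sum_def by (intro sum.mono_neutral_left) auto
  then show "shift_sum \<phi> c f = (\<Sum>l\<in>{-M..M}. c l * \<phi> (\<lambda>x. f (x + of_int l)))"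
    by (simp add: shift_def)
qed

text \<open>Inserting the two-scale relation into \<open>\<Sum>\<^sub>l b\<^sub>l \<phi>(\<cdot> - l)\<close> gives the coefficients
\<open>d\<^sub>k = \<Sum>\<^sub>m a\<^sub>m b\<^bsub>(k - m) / 2\<^esub>\<close>, the sum being over those \<open>m\<close> for which \<open>k - m\<close> is even.\<close>
lemma shift_space_dilation:
  assumes \<phi>: "supported_in \<phi> R" "0 < R"
    and ref: "\<And>g. test_fun g \<Longrightarrow> \<phi> (\<lambda>x. g (2 * x)) = (\<Sum>m\<le>N. a m * \<phi> (\<lambda>x. g (x + real m)))"
    and u: "u \<in> shift_space \<phi>"
  shows "(\<lambda>g. u (\<lambda>x. g (2 * x))) \<in> shift_space \<phi>"
proof -
  obtain b where b: "\<And>g. test_fun g \<Longrightarrow> u g = shift_sum \<phi> b g"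
    using u by (auto simp: shift_space_def dist_eq_def)
  define e where "e m k = (if even (k - int m) then b ((k - int m) div 2) else 0)" for m k
  define d where "d k = (\<Sum>m\<le>N. a m * e m k)" for k
  have "u (\<lambda>x. g (2 * x)) = shift_sum \<phi> d g" if g: "test_fun g" for g
  proof -
    obtain S where S: "S > 0" "supp g \<subseteq> {-S..S}" "\<forall>x. S < \<bar>x\<bar> \<longrightarrow> g x = 0"
      by (rule test_funE[OF g])
    define K where "K = \<lceil>R + S\<rceil>"
    have K: "R + S \<le> of_int K" "0 \<le> K" using S(1) \<phi>(2) by (auto simp: K_def)
    \<comment> \<open>if \<open>l\<close> exceeds \<open>M\<close> in modulus, then \<open>2 l + m\<close> exceeds \<open>K\<close> for every \<open>m\<close> up to \<open>N\<close>\<close>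
    define M where "M = K + int N"
    define M' where "M' = 2 * M + int N"
    define \<Phi> where "\<Phi> k = \<phi> (\<lambda>x. g (x + of_int k))" for k
    have \<Phi>0: "\<Phi> k = 0" if "K < \<bar>k\<bar>" for k
      unfolding \<Phi>_def by (rule shift_sum_eq(2)[OF \<phi>(1) g _ K(1) that]) (use S(3) in blast)
    have "u (\<lambda>x. g (2 * x)) = shift_sum \<phi> b (\<lambda>x. g (2 * x))"
      using b test_fun_affine[OF g, of 2 0] by simp
    also have "\<dots> = (\<Sum>l\<in>{-M..M}. b l * \<phi> (\<lambda>x. g (2 * (x + of_int l))))"
    proof (rule shift_sum_eq(1)[OF \<phi>(1), where S = S])
      show "test_fun (\<lambda>x. g (2 * x))" using test_fun_affine[OF g, of 2 0] by simp
      show "g (2 * x) = 0" if "S < \<bar>x\<bar>" for x using S(3) that by simp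
      show "R + S \<le> of_int M" using K by (simp add: M_def)
    qed
    also have "\<dots> = (\<Sum>l\<in>{-M..M}. \<Sum>m\<le>N. a m * (b l * \<Phi> (2 * l + int m)))"
    proof (rule sum.cong[OF refl])
      fix l
      have "\<phi> (\<lambda>x. g (2 * (x + of_int l))) = (\<Sum>m\<le>N. a m * \<Phi> (2 * l + int m))"
        using ref[OF test_fun_affine[OF g, of 1 "2 * of_int l"]]
        by (simp add: \<Phi>_def algebra_simps)
      then show "b l * \<phi> (\<lambda>x. g (2 * (x + of_int l))) = (\<Sum>m\<le>N. a m * (b l * \<Phi> (2 * l + int m)))"
        by (simp add: sum_distrib_left mult_ac)
    qed
    also have "\<dots> = (\<Sum>m\<le>N. a m * (\<Sum>l\<in>{-M..M}. b l * \<Phi> (2 * l + int m)))"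
      by (subst sum.swap) (simp add: sum_distrib_left)
    also have "\<dots> = (\<Sum>m\<le>N. a m * (\<Sum>k\<in>{-M'..M'}. e m k * \<Phi> k))"
    proof (intro sum.cong[OF refl] arg_cong2[where f = times] refl)
      fix m assume m: "m \<in> {..N}"
      have "(\<Sum>l\<in>{-M..M}. b l * \<Phi> (2 * l + int m)) = (\<Sum>k\<in>(\<lambda>l. 2 * l + int m) ` {-M..M}. e m k * \<Phi> k)"
        by (subst sum.reindex) (auto simp: inj_on_def e_def)
      also have "\<dots> = (\<Sum>k\<in>{-M'..M'}. e m k * \<Phi> k)"
      proof (rule sum.mono_neutral_left)
        show "(\<lambda>l. 2 * l + int m) ` {-M..M} \<subseteq> {-M'..M'}"
          using m by (auto simp: M'_def)
        show "\<forall>k\<in>{-M'..M'} - (\<lambda>l. 2 * l + int m) ` {-M..M}. e m k * \<Phi> k = 0"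
        proof
          fix k assume k: "k \<in> {-M'..M'} - (\<lambda>l. 2 * l + int m) ` {-M..M}"
          show "e m k * \<Phi> k = 0"
          proof (cases "even (k - int m)")
            case True
            then obtain l where "k - int m = 2 * l" by (rule evenE)
            then have l: "k = 2 * l + int m" by simp
            then have "l \<notin> {-M..M}" using k by auto
            then have "K < \<bar>k\<bar>" using l m K(2) by (auto simp: M_def)
            then show ?thesis by (simp add: \<Phi>0)
          qed (simp add: e_def)
        qed
      qed auto
      finally show "(\<Sum>l\<in>{-M..M}. b l * \<Phi> (2 * l + int m)) = (\<Sum>k\<in>{-M'..M'}. e m k * \<Phi> k)" .
    qed
    also have "\<dots> = (\<Sum>k\<in>{-M'..M'}. d k * \<Phi> k)"
      unfolding d_def sum_distrib_right sum_distrib_left by (subst sum.swap) (simp add: mult_ac)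
    also have "\<dots> = shift_sum \<phi> d g"
      unfolding \<Phi>_def using K S(3)
      by (intro shift_sum_eq(1)[OF \<phi>(1) g, symmetric]) (auto simp: M'_def M_def)
    finally show ?thesis .
  qed
  then show ?thesis by (auto simp: shift_space_def dist_eq_def)
qed

lemma regular_dist_dilation:
  "regular_dist (\<lambda>t. f (t / 2)) g = 2 * regular_dist f (\<lambda>x. g (2 * x))"
  unfolding regular_dist_def
  by (subst lborel_integral_real_affine[of 2 _ 0]) (simp_all add: scaleR_conv_of_real)

lemma shift_space_cmult:
  assumes "u \<in> shift_space \<phi>" shows "(\<lambda>g. c * u g) \<in> shift_space \<phi>"
proof -
  obtain b where b: "\<And>g. test_fun g \<Longrightarrow> u g = shift_sum \<phi> b g"
    using assms by (auto simp: shift_space_def dist_eq_def)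
  then have "c * u g = shift_sum \<phi> (\<lambda>l. c * b l) g" if "test_fun g" for g
    using that by (simp add: shift_sum_def sum_distrib_left mult.assoc)
  then show ?thesis by (auto simp: shift_space_def dist_eq_def)
qed

lemma shift_space_regular_dilation:
  assumes \<phi>: "supported_in \<phi> R" "0 < R"
    and ref: "\<And>g. test_fun g \<Longrightarrow> \<phi> (\<lambda>x. g (2 * x)) = (\<Sum>m\<le>N. a m * \<phi> (\<lambda>x. g (x + real m)))"
    and f: "regular_dist f \<in> shift_space \<phi>"
  shows "regular_dist (\<lambda>t. f (t / 2 ^ n)) \<in> shift_space \<phi>"
proof (induction n)
  case (Suc n)
  have "regular_dist (\<lambda>t. f (t / 2 ^ Suc n)) = (\<lambda>g. 2 * regular_dist (\<lambda>t. f (t / 2 ^ n)) (\<lambda>x. g (2 * x)))"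
    using regular_dist_dilation[of "\<lambda>t. f (t / 2 ^ n)"] by (simp add: fun_eq_iff)
  then show ?case
    using shift_space_cmult[OF shift_space_dilation[OF \<phi> ref Suc]] by simp
qed (use f in simp)

text \<open>A homogeneous linear system with more unknowns than equations has a nontrivial solution. The proof
eliminates one equation together with one unknown at a time.\<close>
lemma nontrivial_relation:
  fixes c :: "'n \<Rightarrow> 'l \<Rightarrow> 'a :: field"
  assumes "finite \<Lambda>" "finite S" "card \<Lambda> < card S"
  shows "\<exists>b. (\<exists>n\<in>S. b n \<noteq> 0) \<and> (\<forall>l\<in>\<Lambda>. (\<Sum>n\<in>S. b n * c n l) = 0)"
  using assms
proof (induction arbitrary: S c rule: finite_induct)
  case empty
  then obtain n where "n \<in> S" by (metis card_gt_0_iff card.empty ex_in_conv)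
  then show ?case by (intro exI[of _ "\<lambda>_. 1"]) auto
next
  case (insert k \<Lambda>)
  show ?case
  proof (cases "\<forall>n\<in>S. c n k = 0")
    case True
    then show ?thesis using insert.IH[of S c] insert.prems insert.hyps by auto
  next
    case False
    then obtain n0 where n0: "n0 \<in> S" "c n0 k \<noteq> 0" by blast
    define c' where "c' n l = c n l - c n k / c n0 k * c n0 l" for n l
    have "card \<Lambda> < card (S - {n0})"
      using insert.prems insert.hyps n0 by simp
    then obtain b where b: "\<exists>n\<in>S - {n0}. b n \<noteq> 0" "\<forall>l\<in>\<Lambda>. (\<Sum>n\<in>S - {n0}. b n * c' n l) = 0"
      using insert.IH[of "S - {n0}" c'] insert.prems by blast
    define b' where "b' = b(n0 := - (\<Sum>n\<in>S - {n0}. b n * c n k) / c n0 k)"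
    have "(\<Sum>n\<in>S. b' n * c n l) = (\<Sum>n\<in>S - {n0}. b n * c' n l)" for l
    proof -
      have "(\<Sum>n\<in>S. b' n * c n l) = b' n0 * c n0 l + (\<Sum>n\<in>S - {n0}. b' n * c n l)"
        by (rule sum.remove[OF insert.prems(1) n0(1)])
      also have "(\<Sum>n\<in>S - {n0}. b' n * c n l) = (\<Sum>n\<in>S - {n0}. b n * c n l)"
        by (intro sum.cong) (auto simp: b'_def)
      also have "b' n0 * c n0 l = - (\<Sum>n\<in>S - {n0}. b n * (c n k / c n0 k * c n0 l))"
        by (simp add: b'_def sum_divide_distrib sum_distrib_right mult.assoc)
      finally show ?thesis by (simp add: c'_def right_diff_distrib sum_subtractf)
    qed
    moreover have "c' n k = 0" for n using n0 by (simp add: c'_def)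
    ultimately have "\<forall>l\<in>insert k \<Lambda>. (\<Sum>n\<in>S. b' n * c n l) = 0"
      using b(2) by auto
    moreover have "\<exists>n\<in>S. b' n \<noteq> 0" using b(1) by (auto simp: b'_def)
    ultimately show ?thesis by blast
  qed
qed

text \<open>Against test functions that vanish outside \<open>(-1, 1)\<close>, each dilate of \<open>f\<close> is a combination of the
\<open>2 M + 1\<close> shifts of \<open>\<phi>\<close> by \<open>-M, \<dots>, M\<close>. Any larger number of dilates thus satisfies a linear relation
as distributions on \<open>(-1, 1)\<close>, and continuity makes it a pointwise one.\<close>
lemma dilates_dependent:
  assumes \<phi>: "distribution \<phi>" "supported_in \<phi> R" "0 < R"
    and cont: "continuous_on UNIV f"
    and f: "\<And>n. regular_dist (\<lambda>t. f (t / 2 ^ n)) \<in> shift_space \<phi>"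
  shows "\<exists>b n. (\<exists>i\<le>n. b i \<noteq> 0) \<and> (\<forall>t. \<bar>t\<bar> < 1 \<longrightarrow> (\<Sum>i\<le>n. b i * f (t / 2 ^ i)) = 0)"
proof -
  have "\<forall>n. \<exists>c. \<forall>g. test_fun g \<longrightarrow> regular_dist (\<lambda>t. f (t / 2 ^ n)) g = shift_sum \<phi> c g"
    using f by (auto simp: shift_space_def dist_eq_def)
  then obtain c where c: "\<And>n g. test_fun g \<Longrightarrow> regular_dist (\<lambda>t. f (t / 2 ^ n)) g = shift_sum \<phi> (c n) g"
    by metis
  define M where "M = \<lceil>R + 1\<rceil>"
  have M: "R + 1 \<le> of_int M" by (simp add: M_def)
  define n where "n = card {-M..M}"
  obtain b where b: "\<exists>i\<in>{..n}. b i \<noteq> 0" "\<forall>l\<in>{-M..M}. (\<Sum>i\<in>{..n}. b i * c i l) = 0"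
    using nontrivial_relation[of "{-M..M}" "{..n}" c] by (auto simp: n_def)
  have cont': "continuous_on UNIV (\<lambda>t. f (t / 2 ^ i))" for i
    by (intro continuous_on_compose2[OF cont] continuous_intros) auto
  have "(\<Sum>i\<le>n. b i * f (t / 2 ^ i)) = 0" if "\<bar>t\<bar> < 1" for t
  proof (rule regular_dist_separates[of "\<lambda>t. \<Sum>i\<le>n. b i * f (t / 2 ^ i)" 1])
    show "continuous_on UNIV (\<lambda>t. \<Sum>i\<le>n. b i * f (t / 2 ^ i))"
      by (intro continuous_intros cont')
    fix g assume g: "test_fun g" "\<And>x. 1 \<le> \<bar>x\<bar> \<Longrightarrow> g x = 0"
    have g1: "g x = 0" if "1 < \<bar>x\<bar>" for x using g(2) that by simp
    have int: "integrable lborel (\<lambda>x. f (x / 2 ^ i) * g x)" for i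
      by (rule integrable_continuous_bounded_support[of _ 1])
        (use g1 smooth_imp_continuous_on[OF test_fun_smooth[OF g(1)], of UNIV 0]
         in \<open>auto intro!: continuous_on_mult cont'\<close>)
    have "regular_dist (\<lambda>t. \<Sum>i\<le>n. b i * f (t / 2 ^ i)) g = (\<Sum>i\<le>n. b i * regular_dist (\<lambda>t. f (t / 2 ^ i)) g)"
      unfolding regular_dist_def sum_distrib_right mult.assoc
      by (subst Bochner_Integration.integral_sum) (simp_all add: int)
    also have "\<dots> = (\<Sum>i\<le>n. b i * (\<Sum>l\<in>{-M..M}. c i l * \<phi> (\<lambda>x. g (x + of_int l))))"
      using c[OF g(1)] shift_sum_eq(1)[OF \<phi>(2) g(1) g1 M] by simp
    also have "\<dots> = (\<Sum>l\<in>{-M..M}. (\<Sum>i\<le>n. b i * c i l) * \<phi> (\<lambda>x. g (x + of_int l)))"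
      unfolding sum_distrib_right sum_distrib_left by (subst sum.swap) (simp add: mult.assoc)
    also have "\<dots> = 0" using b(2) by simp
    finally show "regular_dist (\<lambda>t. \<Sum>i\<le>n. b i * f (t / 2 ^ i)) g = 0" .
  qed (use that in simp)
  then show ?thesis using b(1) by blast
qed

section \<open>Real analytic functions with dependent dilates are polynomials\<close>

text \<open>Real analyticity in terms of local holomorphic extensions, for which products and the identity
theorem are at hand.\<close>
definition locally_holomorphic :: "(real \<Rightarrow> complex) \<Rightarrow> bool" where
  "locally_holomorphic f \<longleftrightarrow> (\<forall>x. \<exists>r>0. \<exists>F. F holomorphic_on ball (of_real x) r \<and>
     (\<forall>t. \<bar>t - x\<bar> < r \<longrightarrow> f t = F (of_real t)))"

lemma locally_holomorphicE:
  assumes "locally_holomorphic f"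
  obtains r F where "0 < r" "F holomorphic_on ball (of_real x) r"
    "\<forall>t. \<bar>t - x\<bar> < r \<longrightarrow> f t = F (of_real t)"
  using assms unfolding locally_holomorphic_def by blast

lemma of_real_in_ball: "of_real t \<in> ball (of_real x :: complex) r \<longleftrightarrow> \<bar>t - x\<bar> < r"
  by (simp add: dist_norm abs_minus_commute flip: of_real_diff)

lemma locally_holomorphic_real_analytic:
  assumes "real_analytic f" shows "locally_holomorphic f"
  unfolding locally_holomorphic_def
proof
  fix x
  obtain r c where r: "r > 0" and c: "\<And>t. \<bar>t - x\<bar> < r \<Longrightarrow> (\<lambda>n. c n * of_real (t - x) ^ n) sums f t"
    using assms unfolding real_analytic_def by blast
  define F where "F z = (\<Sum>n. c n * (z - of_real x) ^ n)" for z
  have "F holomorphic_on ball (of_real x) r"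
  proof (rule power_series_holomorphic[where a = c])
    fix w :: complex assume "w \<in> ball (of_real x) r"
    then have w: "norm (w - of_real x) < r" by (simp add: dist_norm norm_minus_commute)
    then obtain s where s: "norm (w - of_real x) < s" "s < r" using dense by blast
    have "0 < s" using s(1) norm_ge_zero le_less_trans by blast
    then have "summable (\<lambda>n. c n * of_real s ^ n)"
      using c[of "x + s"] s(2) by (simp add: sums_summable)
    then have "summable (\<lambda>n. c n * (w - of_real x) ^ n)"
      using s(1) \<open>0 < s\<close> by (elim powser_inside) simp
    then show "(\<lambda>n. c n * (w - of_real x) ^ n) sums F w"
      unfolding F_def by (rule summable_sums)
  qed
  moreover have "f t = F (of_real t)" if "\<bar>t - x\<bar> < r" for t
    using c[OF that] by (simp add: F_def sums_unique)
  ultimately show "\<exists>r>0. \<exists>F. F holomorphic_on ball (of_real x) r \<and> (\<forall>t. \<bar>t - x\<bar> < r \<longrightarrow> f t = F (of_real t))"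
    using r by blast
qed

lemma locally_holomorphic_entire:
  assumes "F holomorphic_on UNIV" shows "locally_holomorphic (\<lambda>t. F (of_real t))"
  unfolding locally_holomorphic_def using assms holomorphic_on_subset zero_less_one by blast

lemma
  assumes "locally_holomorphic f" "locally_holomorphic g"
  shows locally_holomorphic_add: "locally_holomorphic (\<lambda>t. f t + g t)"
    and locally_holomorphic_mult: "locally_holomorphic (\<lambda>t. f t * g t)"
proof -
  have *: "\<exists>r>0. \<exists>F G. F holomorphic_on ball (of_real x) r \<and> G holomorphic_on ball (of_real x) r \<and>
     (\<forall>t. \<bar>t - x\<bar> < r \<longrightarrow> f t = F (of_real t) \<and> g t = G (of_real t))" for x
  proof -
    obtain r F where F: "0 < r" "F holomorphic_on ball (of_real x) r"
      "\<forall>t. \<bar>t - x\<bar> < r \<longrightarrow> f t = F (of_real t)"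
      by (rule locally_holomorphicE[OF assms(1)])
    obtain s G where G: "0 < s" "G holomorphic_on ball (of_real x) s"
      "\<forall>t. \<bar>t - x\<bar> < s \<longrightarrow> g t = G (of_real t)"
      by (rule locally_holomorphicE[OF assms(2)])
    have "F holomorphic_on ball (of_real x) (min r s)" "G holomorphic_on ball (of_real x) (min r s)"
      by (auto intro: holomorphic_on_subset[OF F(2)] holomorphic_on_subset[OF G(2)])
    then show ?thesis using F G by (intro exI[of _ "min r s"]) auto
  qed
  show "locally_holomorphic (\<lambda>t. f t + g t)"
    unfolding locally_holomorphic_def
  proof
    fix x
    obtain r F G where "r > 0" "F holomorphic_on ball (of_real x) r" "G holomorphic_on ball (of_real x) r"
     "\<forall>t. \<bar>t - x\<bar> < r \<longrightarrow> f t = F (of_real t) \<and> g t = G (of_real t)"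
      using * by blast
    then show "\<exists>r>0. \<exists>F. F holomorphic_on ball (of_real x) r \<and> (\<forall>t. \<bar>t - x\<bar> < r \<longrightarrow> f t + g t = F (of_real t))"
      by (intro exI[of _ r] conjI exI[of _ "\<lambda>z. F z + G z"]) (auto intro: holomorphic_on_add)
  qed
  show "locally_holomorphic (\<lambda>t. f t * g t)"
    unfolding locally_holomorphic_def
  proof
    fix x
    obtain r F G where "r > 0" "F holomorphic_on ball (of_real x) r" "G holomorphic_on ball (of_real x) r"
     "\<forall>t. \<bar>t - x\<bar> < r \<longrightarrow> f t = F (of_real t) \<and> g t = G (of_real t)"
      using * by blast
    then show "\<exists>r>0. \<exists>F. F holomorphic_on ball (of_real x) r \<and> (\<forall>t. \<bar>t - x\<bar> < r \<longrightarrow> f t * g t = F (of_real t))"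
      by (intro exI[of _ r] conjI exI[of _ "\<lambda>z. F z * G z"]) (auto intro: holomorphic_on_mult)
  qed
qed

lemma locally_holomorphic_sum:
  fixes n :: nat
  assumes "\<And>i. i \<le> n \<Longrightarrow> locally_holomorphic (f i)"
  shows "locally_holomorphic (\<lambda>t. \<Sum>i\<le>n. f i t)"
  using assms by (induction n) (simp_all add: locally_holomorphic_add)

lemma locally_holomorphic_imp_continuous:
  assumes "locally_holomorphic f" shows "continuous_on UNIV f"
proof (rule continuous_at_imp_continuous_on, rule)
  fix x
  obtain r F where F: "0 < r" "F holomorphic_on ball (of_real x) r"
    "\<forall>t. \<bar>t - x\<bar> < r \<longrightarrow> f t = F (of_real t)"
    by (rule locally_holomorphicE[OF assms])
  have "continuous_on (ball x r) (\<lambda>t. F (of_real t))"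
    by (rule continuous_on_compose2[OF holomorphic_on_imp_continuous_on[OF F(2)]])
       (auto simp: of_real_in_ball dist_real_def abs_minus_commute intro!: continuous_intros)
  then have "continuous_on (ball x r) f"
    using F(3) by (subst continuous_on_cong[OF refl, where g = "\<lambda>t. F (of_real t)"])
      (auto simp: dist_real_def abs_minus_commute)
  then show "isCont f x"
    using F(1) by (simp add: continuous_on_eq_continuous_at)
qed

lemma of_real_islimpt:
  assumes "0 < e" shows "(of_real y :: complex) islimpt of_real ` {t. \<bar>t - y\<bar> < e}"
proof (rule islimptI)
  fix T :: "complex set" assume T: "of_real y \<in> T" "open T"
  then obtain s where s: "0 < s" "ball (of_real y) s \<subseteq> T" using open_contains_ball by blast
  define t where "t = y + min s e / 2"
  have "\<bar>t - y\<bar> < s" "\<bar>t - y\<bar> < e" "t \<noteq> y" using s(1) assms by (auto simp: t_def)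
  then have "of_real t \<in> ball (of_real y :: complex) s" by (simp only: of_real_in_ball)
  then show "\<exists>z\<in>of_real ` {t. \<bar>t - y\<bar> < e}. z \<in> T \<and> z \<noteq> of_real y"
    using s(2) \<open>\<bar>t - y\<bar> < e\<close> \<open>t \<noteq> y\<close> by (intro bexI[of _ "of_real t"]) auto
qed

lemma holomorphic_zero_on_reals:
  assumes "F holomorphic_on ball (of_real x) r" "\<bar>y - x\<bar> < r" "0 < e"
    and zero: "\<And>t. \<bar>t - y\<bar> < e \<Longrightarrow> \<bar>t - x\<bar> < r \<Longrightarrow> F (of_real t) = 0"
    and z: "z \<in> ball (of_real x) r"
  shows "F z = 0"
proof (rule analytic_continuation[OF assms(1) open_ball connected_ball _ _ of_real_islimpt _ z])
  let ?e = "min e (r - \<bar>y - x\<bar>)"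
  show "of_real ` {t. \<bar>t - y\<bar> < ?e} \<subseteq> ball (of_real x :: complex) r"
    by (auto simp del: mem_ball simp: of_real_in_ball)
  show "of_real y \<in> ball (of_real x :: complex) r"
    using assms(2) of_real_in_ball by blast
  show "0 < ?e" using assms by simp
  show "F z = 0" if "z \<in> of_real ` {t. \<bar>t - y\<bar> < ?e}" for z
    using that zero by auto
qed

text \<open>The identity theorem on the real line: the set of points near which \<open>g\<close> vanishes is
nonempty, open and closed.\<close>
lemma locally_holomorphic_zero:
  assumes "locally_holomorphic g" "0 < r" "\<And>t. \<bar>t\<bar> < r \<Longrightarrow> g t = 0"
  shows "g t = 0"
proof -
  define Z where "Z = {x. \<exists>e>0. \<forall>t. \<bar>t - x\<bar> < e \<longrightarrow> g t = 0}"
  have key: "x \<in> Z" if F: "0 < r" "F holomorphic_on ball (of_real x) r"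
    "\<forall>t. \<bar>t - x\<bar> < r \<longrightarrow> g t = F (of_real t)" and y: "y \<in> Z" "\<bar>y - x\<bar> < r" for x y r F
  proof -
    obtain e where e: "e > 0" "\<forall>t. \<bar>t - y\<bar> < e \<longrightarrow> g t = 0" using y(1) by (auto simp: Z_def)
    have "F z = 0" if "z \<in> ball (of_real x) r" for z
      using holomorphic_zero_on_reals[OF F(2) y(2) e(1) _ that] e(2) F(3) by metis
    then have "g t = 0" if "\<bar>t - x\<bar> < r" for t
      using F(3) that of_real_in_ball[of t x r] by simp
    then show ?thesis using F(1) by (auto simp: Z_def)
  qed
  have "open Z"
    unfolding open_dist
  proof
    fix x assume x: "x \<in> Z"
    then obtain e where e: "e > 0" "\<forall>t. \<bar>t - x\<bar> < e \<longrightarrow> g t = 0" by (auto simp: Z_def)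
    have "y \<in> Z" if "dist y x < e" for y
    proof -
      have "g t = 0" if "\<bar>t - y\<bar> < e - \<bar>y - x\<bar>" for t
        using that by (intro e(2)[rule_format]) linarith
      then show ?thesis using that unfolding Z_def dist_real_def
        by (intro CollectI exI[of _ "e - \<bar>y - x\<bar>"]) auto
    qed
    then show "\<exists>e>0. \<forall>y. dist y x < e \<longrightarrow> y \<in> Z" using e(1) by blast
  qed
  moreover have "open (- Z)"
    unfolding open_dist
  proof
    fix x assume x: "x \<in> - Z"
    obtain r F where F: "0 < r" "F holomorphic_on ball (of_real x) r"
      "\<forall>t. \<bar>t - x\<bar> < r \<longrightarrow> g t = F (of_real t)"
      by (rule locally_holomorphicE[OF assms(1)])
    show "\<exists>e>0. \<forall>y. dist y x < e \<longrightarrow> y \<in> - Z"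
      using key[OF F] x F(1) by (auto simp: dist_real_def)
  qed
  ultimately have "Z = {} \<or> Z = UNIV"
    using clopen[of Z] by (simp add: closed_def)
  moreover have "0 \<in> Z" using assms(2,3) by (auto simp: Z_def)
  ultimately have "t \<in> Z" by auto
  then show ?thesis unfolding Z_def by force
qed

lemma powser_zero_coeff:
  fixes a :: "nat \<Rightarrow> complex"
  assumes "0 < r" "\<And>z. norm z < r \<Longrightarrow> (\<lambda>n. a n * z ^ n) sums 0"
  shows "a m = 0"
proof (cases "m = 0")
  case True
  have "(\<lambda>n. a n * 0 ^ n) sums a 0" by (rule powser_sums_zero)
  then show ?thesis using assms(1) assms(2)[of 0] sums_unique2 True by (metis norm_zero)
next
  case False
  show ?thesis
  proof (rule ccontr)
    assume "a m \<noteq> 0"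
    show False
    proof (rule powser_0_nonzero[of r 0 a "\<lambda>_. 0" m])
      fix s :: real assume s: "0 < s" "\<And>z::complex. z \<in> cball 0 s - {0} \<Longrightarrow> (0::complex) \<noteq> 0"
      show False using s(2)[of "of_real s"] s(1) by simp
    qed (use assms \<open>a m \<noteq> 0\<close> False in auto)
  qed
qed

text \<open>The relation multiplies the Taylor coefficient \<open>q\<^sub>k\<close> at 0 by \<open>B(2^-k)\<close>, where \<open>B\<close> is the
polynomial with coefficients \<open>b\<^sub>i\<close>. Since the numbers \<open>2^-k\<close> are distinct and \<open>B\<close> has finitely many
roots, almost all \<open>q\<^sub>k\<close> are 0.\<close>
lemma dilates_dependent_imp_polynomial:
  assumes f: "locally_holomorphic f"
    and b: "i \<le> n" "b i \<noteq> 0"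
    and rel: "\<And>t. \<bar>t\<bar> < 1 \<Longrightarrow> (\<Sum>i\<le>n. b i * f (t / 2 ^ i)) = 0"
  shows "\<exists>P. \<forall>t. f t = poly P (of_real t)"
proof -
  obtain r0 F where F0: "0 < r0" "F holomorphic_on ball (of_real 0) r0"
    "\<forall>t. \<bar>t - 0\<bar> < r0 \<longrightarrow> f t = F (of_real t)"
    by (rule locally_holomorphicE[OF f])
  \<comment> \<open>the relation is known only for \<open>\<bar>t\<bar> < 1\<close>\<close>
  define r where "r = min r0 1"
  have r: "0 < r" "r \<le> 1" using F0(1) by (auto simp: r_def)
  have F: "F holomorphic_on ball 0 r" "\<And>t. \<bar>t\<bar> < r \<Longrightarrow> f t = F (of_real t)"
    using F0 by (auto simp: r_def intro: holomorphic_on_subset)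
  have small: "norm (z / 2 ^ i) < r" if "norm z < r" for z :: complex and i
  proof -
    have "norm (z / 2 ^ i) \<le> norm z"
      by (simp add: norm_divide norm_power divide_le_eq mult_le_cancel_left1 mult_left_le_one_le)
    then show ?thesis using that by simp
  qed
  define q where "q k = (deriv ^^ k) F 0 / fact k" for k
  have q: "(\<lambda>k. q k * z ^ k) sums F z" if "norm z < r" for z
    using holomorphic_power_series[OF F(1), of z] that by (simp add: q_def)
  define H where "H z = (\<Sum>i\<le>n. b i * F (z / 2 ^ i))" for z
  have "H holomorphic_on ball (of_real 0) r"
    unfolding H_def
    by (intro holomorphic_intros holomorphic_on_compose_gen[OF _ F(1), unfolded o_def])
       (use small in auto)
  moreover have "H (of_real t) = 0" if "\<bar>t\<bar> < r" for t
  proof -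
    have "H (of_real t) = (\<Sum>i\<le>n. b i * f (t / 2 ^ i))"
      unfolding H_def
    proof (intro sum.cong refl arg_cong2[where f = times])
      fix i
      have "\<bar>t / 2 ^ i\<bar> < r" using small[of "of_real t" i] that by (simp add: norm_divide norm_power)
      then show "F (of_real t / 2 ^ i) = f (t / 2 ^ i)" using F(2) by simp
    qed
    then show ?thesis using rel that r(2) by simp
  qed
  ultimately have H0: "H z = 0" if "norm z < r" for z
    using holomorphic_zero_on_reals[of H 0 r 0 r z] that r(1) by simp
  define B where "B = (\<Sum>i\<le>n. monom (b i) i)"
  have coeff: "q k * poly B ((1 / 2) ^ k) = 0" for k
  proof (rule powser_zero_coeff[OF r(1)])
    fix z :: complex assume z: "norm z < r"
    have "(\<lambda>k. \<Sum>i\<le>n. b i * (q k * (z / 2 ^ i) ^ k)) sums (\<Sum>i\<le>n. b i * F (z / 2 ^ i))"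
      by (intro sums_sum sums_mult q small z)
    moreover have "(\<Sum>i\<le>n. b i * (q k * (z / 2 ^ i) ^ k)) = q k * poly B ((1 / 2) ^ k) * z ^ k" for k
      by (simp add: B_def poly_sum poly_monom sum_distrib_left sum_distrib_right power_divide
          power_mult[symmetric] mult_ac)
    ultimately show "(\<lambda>k. q k * poly B ((1 / 2) ^ k) * z ^ k) sums 0"
      using H0[OF z] by (simp add: H_def)
  qed
  have "coeff B i = b i"
    using b(1) by (simp add: B_def coeff_sum)
  then have "B \<noteq> 0" using b(2) by auto
  have "finite {k. q k \<noteq> 0}"
  proof (rule finite_imageD)
    have "(\<lambda>k. (1 / 2) ^ k) ` {k. q k \<noteq> 0} \<subseteq> {z. poly B z = 0}"
      using coeff by auto
    then show "finite ((\<lambda>k. (1 / 2 :: complex) ^ k) ` {k. q k \<noteq> 0})"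
      using poly_roots_finite[OF \<open>B \<noteq> 0\<close>] finite_subset by blast
    show "inj_on (\<lambda>k. (1 / 2 :: complex) ^ k) {k. q k \<noteq> 0}"
    proof (rule inj_onI)
      fix j k assume "(1 / 2 :: complex) ^ j = (1 / 2) ^ k"
      then have "of_nat (2 ^ j) = (of_nat (2 ^ k) :: complex)" by (simp add: power_one_over)
      then have "(2::nat) ^ j = 2 ^ k" by (simp only: of_nat_eq_iff)
      then show "j = k" by simp
    qed
  qed
  define P where "P = (\<Sum>k | q k \<noteq> 0. monom (q k) k)"
  have near: "f t = poly P (of_real t)" if "\<bar>t\<bar> < r" for t
  proof -
    have "(\<lambda>k. q k * of_real t ^ k) sums (\<Sum>k | q k \<noteq> 0. q k * of_real t ^ k)"
      using \<open>finite {k. q k \<noteq> 0}\<close> by (intro sums_finite) auto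
    then have "F (of_real t) = (\<Sum>k | q k \<noteq> 0. q k * of_real t ^ k)"
      using q[of "of_real t"] that sums_unique2 by auto
    then show ?thesis using F(2)[OF that] by (simp add: P_def poly_sum poly_monom)
  qed
  have "locally_holomorphic (\<lambda>t. f t + poly (- P) (of_real t))"
    by (intro locally_holomorphic_add f locally_holomorphic_entire[of "poly (- P)"] holomorphic_intros)
  then have "f t + poly (- P) (of_real t) = 0" for t
    by (rule locally_holomorphic_zero[OF _ r(1)]) (simp add: near)
  then show ?thesis by (intro exI[of _ P]) (simp add: add_eq_0_iff2)
qed

section \<open>Polynomials with periodic coefficients\<close>

lemma poly_shift_ratio_tendsto_1:
  fixes Q :: "complex poly"
  assumes "Q \<noteq> 0"
  shows "(\<lambda>n. poly Q (of_nat (Suc n)) / poly Q (of_nat n)) \<longlonglongrightarrow> 1"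
proof -
  define Q' where "Q' = pcompose Q [:1, 1:]"
  have deg: "degree Q' = degree Q"
    by (simp add: Q'_def degree_pcompose)
  have lead: "lead_coeff Q' = lead_coeff Q"
    using lead_coeff_comp[of "[:1, 1:]" Q] by (simp add: Q'_def)
  have lim: "(\<lambda>n. poly p (of_nat n) / of_nat n ^ degree p) \<longlonglongrightarrow> lead_coeff p" for p :: "complex poly"
    by (rule filterlim_compose[OF poly_divide_tendsto_aux tendsto_of_nat])
  have "(\<lambda>n. (poly Q' (of_nat n) / of_nat n ^ degree Q) / (poly Q (of_nat n) / of_nat n ^ degree Q))
      \<longlonglongrightarrow> lead_coeff Q / lead_coeff Q"
    using lim[of Q', unfolded lead, unfolded deg] lim[of Q] assms by (intro tendsto_divide) auto
  moreover have "\<forall>\<^sub>F n in sequentially. (poly Q' (of_nat n) / of_nat n ^ degree Q) / (poly Q (of_nat n) / of_nat n ^ degree Q)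
      = poly Q (of_nat (Suc n)) / poly Q (of_nat n)"
    using eventually_gt_at_top[of 0] by eventually_elim (simp add: Q'_def poly_pcompose)
  ultimately have "(\<lambda>n. poly Q (of_nat (Suc n)) / poly Q (of_nat n)) \<longlonglongrightarrow> lead_coeff Q / lead_coeff Q"
    by (rule Lim_transform_eventually)
  then show ?thesis using assms by simp
qed

text \<open>Dividing the identity for \<open>n + 1\<close> by the one for \<open>n\<close> exhibits the constant \<open>z\<close> as a quotient of two
sequences that tend to 1.\<close>
lemma exponential_times_poly_eq_poly:
  fixes Q R :: "complex poly"
  assumes "Q \<noteq> 0" "z \<noteq> 0" and eq: "\<And>n. z ^ n * poly Q (of_nat n) = poly R (of_nat n)"
  shows "z = 1"
proof -
  have fin: "\<forall>\<^sub>F n in sequentially. poly Q (of_nat n) \<noteq> 0"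
  proof -
    have "finite (of_nat -` {x. poly Q x = 0} :: nat set)"
      by (rule finite_vimageI[OF poly_roots_finite[OF assms(1)]]) (simp add: inj_def)
    then show ?thesis
      by (simp add: eventually_cofinite vimage_def flip: cofinite_eq_sequentially)
  qed
  have "R \<noteq> 0"
  proof
    assume "R = 0"
    then have "poly Q (of_nat n) = 0" for n using eq[of n] assms(2) by simp
    then show False using fin by simp
  qed
  have "(\<lambda>n. (poly R (of_nat (Suc n)) / poly R (of_nat n)) / (poly Q (of_nat (Suc n)) / poly Q (of_nat n))) \<longlonglongrightarrow> 1 / 1"
    by (intro tendsto_divide poly_shift_ratio_tendsto_1 \<open>R \<noteq> 0\<close> assms(1)) simp
  moreover have "\<forall>\<^sub>F n in sequentially.
      (poly R (of_nat (Suc n)) / poly R (of_nat n)) / (poly Q (of_nat (Suc n)) / poly Q (of_nat n)) = z"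
    using fin fin[THEN eventually_sequentially_Suc[THEN iffD2]]
    by eventually_elim (simp add: eq[symmetric] assms(2) del: of_nat_Suc)
  ultimately have "(\<lambda>n. z) \<longlonglongrightarrow> 1 / 1"
    by (rule Lim_transform_eventually)
  then show ?thesis by (simp add: LIMSEQ_const_iff)
qed

lemma periodic_nat:
  fixes \<omega> :: "real \<Rightarrow> complex"
  assumes "\<And>t. \<omega> (t + 1) = \<omega> t" shows "\<omega> (t + real n) = \<omega> t"
proof (induction n)
  case (Suc n)
  then show ?case using assms[of "t + real n"] by (simp add: add_ac)
qed simp

lemma poly_eq_on_translates:
  fixes A B :: "complex poly"
  assumes "\<And>n. poly A (t + of_nat n) = poly B (t + of_nat n)"
  shows "A = B"
proof (rule ccontr)
  assume "A \<noteq> B"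
  then have "finite {x. poly (A - B) x = 0}" by (intro poly_roots_finite) simp
  moreover have "range (\<lambda>n. t + of_nat n) \<subseteq> {x. poly (A - B) x = 0}"
    using assms by auto
  ultimately have "finite (range (\<lambda>n. t + of_nat n :: complex))"
    by (rule finite_subset[rotated])
  then show False
    using finite_imageD[of "\<lambda>n. t + of_nat n :: complex" UNIV] by (simp add: inj_def)
qed

text \<open>For fixed \<open>t\<close> let \<open>Q t\<close> be the polynomial \<open>\<Sum>\<^sub>k \<omega>\<^sub>k(t) p\<^sub>k\<close>. By periodicity \<open>P\<close> and
\<open>e^(\<mu> t) Q t\<close> agree at the points \<open>t + n\<close> up to the factor \<open>e^(\<mu> n)\<close>. Choosing \<open>t\<close> with
\<open>\<omega>\<^sub>d(t) \<noteq> 0\<close> makes \<open>Q t\<close> nonzero and gives \<open>e^\<mu> = 1\<close>. After that, \<open>P = e^(\<mu> t) Q t\<close> for every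
\<open>t\<close>: the coefficients of the right-hand side do not depend on \<open>t\<close>, and the coefficient of degree \<open>k\<close>
involves only \<open>\<omega>\<^sub>k, \<dots>, \<omega>\<^sub>d\<close>.\<close>
lemma polynomial_periodic_expansion:
  fixes p :: "nat \<Rightarrow> complex poly" and \<omega> :: "nat \<Rightarrow> real \<Rightarrow> complex"
  assumes p: "\<And>k. k \<le> d \<Longrightarrow> (p k \<noteq> 0 \<and> degree (p k) = k) \<or> (p k = 0 \<and> \<omega> k = (\<lambda>t. 0))"
    and per: "\<And>k t. k \<le> d \<Longrightarrow> \<omega> k (t + 1) = \<omega> k t"
    and nz: "\<omega> d \<noteq> (\<lambda>t. 0)"
    and P: "\<And>t. exp (\<mu> * of_real t) * (\<Sum>k\<le>d. poly (p k) (of_real t) * \<omega> k t) = poly P (of_real t)"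
  shows "exp \<mu> = 1"
    and "\<And>k. k \<le> d \<Longrightarrow> \<exists>c. \<forall>t. exp (\<mu> * of_real t) * \<omega> k t = c"
proof -
  define Q where "Q t = (\<Sum>k\<le>d. smult (\<omega> k t) (p k))" for t
  have coeff_Q: "coeff (Q t) j = (\<Sum>k\<le>d. \<omega> k t * coeff (p k) j)" for t j
    by (simp add: Q_def coeff_sum)
  have eq: "exp \<mu> ^ n * (exp (\<mu> * of_real t) * poly (Q t) (of_real t + of_nat n)) = poly P (of_real t + of_nat n)" for t n
  proof -
    have "exp (\<mu> * of_real (t + real n)) = exp \<mu> ^ n * exp (\<mu> * of_real t)"
      by (simp add: algebra_simps exp_add exp_of_nat_mult[symmetric])
    moreover have "(\<Sum>k\<le>d. poly (p k) (of_real (t + real n)) * \<omega> k (t + real n)) =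
        poly (Q t) (of_real t + of_nat n)"
      using periodic_nat[of "\<omega> _", OF per]
      by (simp add: Q_def poly_sum mult.commute)
    ultimately show ?thesis using P[of "t + real n"] by (simp add: mult.assoc)
  qed
  obtain t0 where t0: "\<omega> d t0 \<noteq> 0" using nz by (auto simp: fun_eq_iff)
  have "coeff (Q t0) d = \<omega> d t0 * coeff (p d) d"
  proof -
    have "coeff (Q t0) d = (\<Sum>k\<in>{d}. \<omega> k t0 * coeff (p k) d)"
      unfolding coeff_Q
    proof (rule sum.mono_neutral_right)
      show "\<forall>k\<in>{..d} - {d}. \<omega> k t0 * coeff (p k) d = 0"
      proof
        fix k assume "k \<in> {..d} - {d}"
        then have "k < d" by auto
        then show "\<omega> k t0 * coeff (p k) d = 0" using p[of k] by (auto simp: coeff_eq_0)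
      qed
    qed auto
    then show ?thesis by simp
  qed
  moreover have "coeff (p d) d \<noteq> 0"
    using p[of d] t0 by (metis leading_coeff_0_iff order_refl)
  ultimately have "Q t0 \<noteq> 0" using t0 by auto
  show one: "exp \<mu> = 1"
  proof (rule exponential_times_poly_eq_poly)
    show "pcompose (smult (exp (\<mu> * of_real t0)) (Q t0)) [:of_real t0, 1:] \<noteq> 0"
      using \<open>Q t0 \<noteq> 0\<close> by (simp add: pcompose_eq_0_iff)
    show "exp \<mu> ^ n * poly (pcompose (smult (exp (\<mu> * of_real t0)) (Q t0)) [:of_real t0, 1:]) (of_nat n) =
        poly (pcompose P [:of_real t0, 1:]) (of_nat n)" for n
      using eq[of n t0] by (simp add: poly_pcompose)
  qed simp
  have "smult (exp (\<mu> * of_real t)) (Q t) = P" for t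
    by (rule poly_eq_on_translates[of _ "of_real t"]) (use eq[of _ t] one in simp)
  then have coeff_P: "coeff P j = (\<Sum>k\<le>d. (exp (\<mu> * of_real t) * \<omega> k t) * coeff (p k) j)" for t j
    by (metis (no_types, lifting) coeff_Q coeff_smult mult.assoc sum.cong sum_distrib_left)
  show "\<exists>c. \<forall>t. exp (\<mu> * of_real t) * \<omega> k t = c" if "k \<le> d" for k
    using that
  proof (induction "d - k" arbitrary: k rule: less_induct)
    case less
    show ?case
    proof (cases "p k = 0")
      case True
      then show ?thesis using p[OF less.prems] by auto
    next
      case False
      then have lead: "coeff (p k) k \<noteq> 0" using p[OF less.prems] by (metis leading_coeff_0_iff)
      have "\<forall>j. \<exists>c. j \<in> {k<..d} \<longrightarrow> (\<forall>t. exp (\<mu> * of_real t) * \<omega> j t = c)"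
        using less.hyps by fastforce
      then obtain c where c: "\<And>j t. j \<in> {k<..d} \<Longrightarrow> exp (\<mu> * of_real t) * \<omega> j t = c j"
        by metis
      have "exp (\<mu> * of_real t) * \<omega> k t = (coeff P k - (\<Sum>j\<in>{k<..d}. c j * coeff (p j) k)) / coeff (p k) k" for t
      proof -
        have "coeff P k = (\<Sum>j\<in>{k..d}. (exp (\<mu> * of_real t) * \<omega> j t) * coeff (p j) k)"
          unfolding coeff_P[of k t]
        proof (rule sum.mono_neutral_right)
          show "\<forall>j\<in>{..d} - {k..d}. exp (\<mu> * of_real t) * \<omega> j t * coeff (p j) k = 0"
          proof
            fix j assume "j \<in> {..d} - {k..d}"
            then have "j < k" "j \<le> d" by auto
            then show "exp (\<mu> * of_real t) * \<omega> j t * coeff (p j) k = 0"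
              using p[of j] by (auto simp: coeff_eq_0)
          qed
        qed auto
        also have "{k..d} = insert k {k<..d}" using less.prems by auto
        finally have "coeff P k = exp (\<mu> * of_real t) * \<omega> k t * coeff (p k) k + (\<Sum>j\<in>{k<..d}. c j * coeff (p j) k)"
          using c by simp
        then show ?thesis using lead by (simp add: field_simps)
      qed
      then show ?thesis by blast
    qed
  qed
qed

section \<open>Analytic functions in the shift-invariant space\<close>

lemma analytic_in_shift_space_imp_polynomial:
  assumes a: "trig_poly N a"
    and \<phi>: "distribution \<phi>" "compactly_supported \<phi>"
    and prod: "\<And>y. (\<lambda>j. a (y / 2 ^ Suc j)) has_prod fourier \<phi> y"
    and f: "locally_holomorphic f" "regular_dist f \<in> shift_space \<phi>"
  shows "\<exists>P. \<forall>t. f t = poly P (of_real t)"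
proof -
  obtain c :: "nat \<Rightarrow> real" where
    c: "\<And>y. a y = (\<Sum>m\<le>N. of_real (c m) * exp (- (2 * of_real pi * \<i> * of_nat m * of_real y)))"
    using a by (auto simp: trig_poly_def)
  obtain R where R: "0 < R" "supported_in \<phi> R"
    by (rule compactly_supported_supported_in[OF \<phi>(2)])
  have "regular_dist (\<lambda>t. f (t / 2 ^ n)) \<in> shift_space \<phi>" for n
    by (rule shift_space_regular_dilation[OF R(2,1) refinement_equation[OF \<phi> c prod] f(2)])
  then obtain b n where "\<exists>i\<le>n. b i \<noteq> 0" "\<forall>t. \<bar>t\<bar> < 1 \<longrightarrow> (\<Sum>i\<le>n. b i * f (t / 2 ^ i)) = 0"
    using dilates_dependent[OF \<phi>(1) R(2,1) locally_holomorphic_imp_continuous[OF f(1)]] by blast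
  then show ?thesis
    using dilates_dependent_imp_polynomial[OF f(1)] by blast
qed

theorem corollary4p5:
  fixes N d :: nat
    and C :: real
    and a :: "real \<Rightarrow> complex"
    and \<phi> :: functional
    and \<mu> :: complex
    and p :: "nat \<Rightarrow> complex poly"
    and \<omega> :: "nat \<Rightarrow> real \<Rightarrow> complex"
  assumes "N \<ge> 1"
    and "trig_poly N a" and "a 0 = 1" and "max_norm a \<le> C"
    and "distribution \<phi>" and "compactly_supported \<phi>"
    and "\<And>y. (\<lambda>j. a (y / 2 ^ Suc j)) has_prod fourier \<phi> y"
    and "independent_shifts \<phi>"
    and "d \<le> N"
    and "\<And>k. k \<le> d \<Longrightarrow> (p k \<noteq> 0 \<and> degree (p k) = k) \<or> (p k = 0 \<and> \<omega> k = (\<lambda>t. 0))"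
    and "\<And>k t. k \<le> d \<Longrightarrow> \<omega> k (t + 1) = \<omega> k t"
    and "\<And>k. k \<le> d \<Longrightarrow> real_analytic (\<omega> k)"
    and "\<omega> d \<noteq> (\<lambda>t. 0)"
    and "regular_dist (\<lambda>t. exp (\<mu> * of_real t) * (\<Sum>k\<le>d. poly (p k) (of_real t) * \<omega> k t))
           \<in> shift_space \<phi>"
  shows "(unambiguous_frequency \<mu> d \<omega> \<longrightarrow> \<mu> = 0 \<and> (\<forall>k\<le>d. \<omega> k constant_on UNIV)) \<and>
         (\<exists>n::int. \<mu> = 2 * of_real pi * \<i> * of_int n \<and>
            (\<forall>k\<le>d. (\<lambda>t. exp (\<mu> * of_real t) * \<omega> k t) constant_on UNIV))"
proof -
  let ?f = "\<lambda>t. exp (\<mu> * of_real t) * (\<Sum>k\<le>d. poly (p k) (of_real t) * \<omega> k t)"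
  have "locally_holomorphic ?f"
    by (intro locally_holomorphic_mult locally_holomorphic_sum
        locally_holomorphic_entire[of "\<lambda>z. exp (\<mu> * z)"] locally_holomorphic_entire[of "poly (p _)"]
        locally_holomorphic_real_analytic assms(12) holomorphic_intros)
  then obtain P where P: "\<And>t. ?f t = poly P (of_real t)"
    using analytic_in_shift_space_imp_polynomial[OF assms(2,5,6,7) _ assms(14)] by blast
  note expansion = polynomial_periodic_expansion[OF assms(10,11,13) P]
  have "exp \<mu> = 1" by (rule expansion(1))
  then obtain n :: int where "Re \<mu> = 0" "Im \<mu> = of_int (2 * n) * pi"
    by (auto simp: exp_eq_1)
  then have \<mu>: "\<mu> = 2 * of_real pi * \<i> * of_int n"
    by (simp add: complex_eq_iff)
  have const: "(\<lambda>t. exp (\<mu> * of_real t) * \<omega> k t) constant_on UNIV" if "k \<le> d" for k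
  proof -
    have "\<exists>c. \<forall>t. exp (\<mu> * of_real t) * \<omega> k t = c"
      by (rule expansion(2)[OF _ _ that])
    then show ?thesis by (auto simp: constant_on_def)
  qed
  have "\<mu> = 0" if un: "unambiguous_frequency \<mu> d \<omega>"
  proof -
    have "n = 0"
    proof (rule ccontr)
      assume "n \<noteq> 0"
      have "\<bar>Im \<mu>\<bar> \<ge> 2 * pi" using \<open>n \<noteq> 0\<close> by (simp add: \<mu> abs_mult)
      then have real: "\<omega> d t \<in> \<real>" for t using un by (auto simp: unambiguous_frequency_def)
      obtain e where e: "\<And>t. exp (\<mu> * of_real t) * \<omega> d t = e"
        using const[of d] by (auto simp: constant_on_def)
      \<comment> \<open>the constant \<open>e\<close> is real by its value at 0 and imaginary by its value at \<open>1 / (4 n)\<close>\<close>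
      have "e \<in> \<real>" using e[of 0] real[of 0] by simp
      have "exp (\<mu> * of_real (1 / (4 * of_int n))) = \<i>"
      proof -
        have quarter: "\<mu> * of_real (1 / (4 * of_int n)) = \<i> * of_real (pi / 2)"
          using \<open>n \<noteq> 0\<close> by (simp add: \<mu> field_simps)
        show ?thesis
          unfolding quarter exp_Euler cos_of_real sin_of_real cos_pi_half sin_pi_half by simp
      qed
      then have "\<i> * \<omega> d (1 / (4 * of_int n)) = e" using e by metis
      then have "e = 0" using \<open>e \<in> \<real>\<close> real[of "1 / (4 * of_int n)"]
        by (auto simp: complex_is_Real_iff complex_eq_iff)
      then have "\<omega> d = (\<lambda>t. 0)" using e by (simp add: fun_eq_iff)
      then show False using assms(13) by simp
    qed
    then show ?thesis by (simp add: \<mu>)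
  qed
  then show ?thesis using \<mu> const by auto
qed

end
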